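(* Let $\mathcal{A}\colon\mathbb{G}^{\mathrm{op}}\to\mathsf{ADD}$ be a restriction 2-functor, let $G\in\mathbb{G}$ and let $(H,x)\in\mathcal{A}_\oplus(G)$ be an object. Then $\mu_{\mathcal{A},G}(H,x)$ in $\mathcal{A}^\oplus(G)$ is given at level $K\in\mathbb{G}/G$ by the following object of $\mathcal{A}(K)$: $$\big(\mu_{\mathcal{A},G}(H,x)\big)_K=(p_2)_*\,(p_1)^*(x),$$ where $p_1$ and $p_2$ are the restrictions of the two projections $\mathrm{pr}_1\colon H\times_GK\to H$ and $\mathrm{pr}_2\colon H\times_GK\to K$ of the isocomma $H\times_GK=(\varsigma_H/\varsigma_K)$ to the union of those connected components of $H\times_GK$ on which $\mathrm{pr}_2$ is fully faithful, and where $(p_2)_*$ is the folding induction in $\mathcal{A}$ along the local equivalence $p_2$.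
   Context: **Setting.** $\mathsf{gpd}$ is the 2-category of finite groupoids, functors and natural transformations. Throughout, $\mathbb{G}$ is one of: (1) $\mathsf{gpd}$; (2) $\mathsf{gpd}^{\mathsf f}$, with the same objects and 2-cells but only faithful functors as 1-morphisms; (3) $\mathsf{gpd}^{\mathsf f}_{/\Gamma}$ for a fixed finite group $\Gamma$, the comma 2-category of finite groupoids equipped with a faithful functor to $\Gamma$ (1-morphisms are functors with a natural isomorphism comparing the functors to $\Gamma$; 2-cells are compatible natural transformations). Connected components, faithfulness, isocommas, etc. refer to underlying groupoids. $\mathsf{ADD}$ is the 2-category of additive categories, additive functors and natural transformations. **Restriction 2-functors.** Strict 2-functors $\mathcal{A}\colon\mathbb{G}^{\mathrm{op}}\to\mathsf{ADD}$, $u\mapsto u^*$ (contravariant), $\alpha\mapsto\alpha^*$ (covariant), that are additive: $(\mathrm{incl}_1^*,\mathrm{incl}_2^* )\colon\mathcal{A}(G_1\sqcup G_2)\to\mathcal{A}(G_1)\oplus\mathcal{A}(G_2)$ is an equivalence. Morphisms are pseudo-natural transformations $(t_G,t_u\colon u^*t_G\Rightarrow t_Hu^* )$. **Isocommas.** For $H\xrightarrow{i}G\xleftarrow{u}K$, $H\times_GK=(i/u)$ has objects $(a,b,g\colon i(a)\xrightarrow{\sim}u(b))$, morphisms $(h,k)$ with $g_2\,i(h)=u(k)\,g_1$, projections $\mathrm{pr}_1,\mathrm{pr}_2$. A 2-cell $\gamma\colon iv\Rightarrow uj$ ($v\colon L\to H$, $j\colon L\to K$) is a Mackey square if $L\to(i/u)$,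 $a\mapsto(v(a),j(a),\gamma_a)$, is an equivalence. **Mackey 2-functors.** Restriction 2-functors $\mathcal{M}$ in which every $i^*$, $i$ faithful, has a two-sided adjoint $i_*$ with ${}^{\ell}\eta,{}^{\ell}\varepsilon$ (for $i_*\dashv i^*$) and ${}^{r}\eta,{}^{r}\varepsilon$ (for $i^*\dashv i_*$) satisfying ${}^{r}\varepsilon\circ{}^{\ell}\eta=\mathrm{id}$, and such that for every Mackey square with $i,j$ faithful the mates $j_*v^*\Rightarrow u^*i_*$ and $u^*i_*\Rightarrow j_*v^*$ of $\gamma^*$ and $(\gamma^{-1})^*$ are isomorphisms. Morphisms of Mackey 2-functors are morphisms $t$ of restriction 2-functors whose right mates $t_Gi_*\Rightarrow i_*t_H$ are isomorphisms for $i\colon H\to G$ faithful. **Local equivalences, folding induction, trace.** $s\colon H\to G$ is a local equivalence if its restriction to each component of $H$ is fully faithful. Then $s^*\colon\mathcal{A}(G)\to\mathcal{A}(H)$ has a two-sided adjoint $s_*$ (folding induction): $s_*(y)_L=\bigoplus_M((s|_M)^* )^{-1}(y_M)$ over components $M$ of $H$ mapped to the component $L$ of $G$, with obvious (co)units. For $f\colon s^*c_1\to s^*c_2$, $\mathrm{tr}_s(f)\colon c_1\xrightarrow{{}^r\eta}s_*s^*c_1\xrightarrow{s_*f}s_*s^*c_2\xrightarrow{{}^\ell\varepsilon}c_2$. **Comma 2-categories.** $\mathbb{G}/G$ has objects $H\in\mathbb{G}$ with structure morphism $\varsigma_H\colon H\to G$; 1-morphisms $f\colon H\to K$ with a 2-cell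 $\varsigma_f\colon\varsigma_H\Rightarrow\varsigma_Kf$; 2-cells $\alpha\colon f\Rightarrow f'$ with $(\varsigma_K\alpha)\varsigma_f=\varsigma_{f'}$. $\mathbb{G}^{\mathsf f}/G$ is the part where $\varsigma_H$ is faithful. For $j\colon G'\to G$: $j_!H'=H'$ with $\varsigma_{j_!H'}=j\varsigma_{H'}$; $j^*H=(j/\varsigma_H)$ with structure morphism $\mathrm{pr}_1$, and $j^*f\colon(a,b,g)\mapsto(a,f(b),(\varsigma_f)_b\,g)$. **$\mathcal{A}_\oplus$.** Objects of $\mathcal{A}_\oplus(G)$: pairs $(H,x)$, $H\in\mathbb{G}^{\mathsf f}/G$, $x\in\mathcal{A}(H)$. Morphisms $(H,x)\to(K,y)$: classes $[P,p_1,p_2;f]$ where $H\xleftarrow{p_1}P\xrightarrow{p_2}K$ is a span in $\mathbb{G}^{\mathsf f}/G$ and $f\colon p_1^*x\to p_2^*y$ in $\mathcal{A}(P)$, modulo the equivalence relation generated by $(P,p_1,p_2;f)\approx(P',p_1',p_2';f')$ whenever there are a local equivalence $s\colon P\to P'$ in $\mathbb{G}/G$ and 2-cells $\sigma_i\colon p_i\Rightarrow p_i's$ in $\mathbb{G}/G$ with $f'=\mathrm{tr}_s(\sigma_2^*f(\sigma_1^* )^{-1})$. Composition: $[Q,q_1,q_2;g]\circ[P,p_1,p_2;f]=[T,p_1u,q_2v;v^*(g)\gamma^*u^*(f)]$ for any Mackey square $\gamma\colon p_2u\Rightarrow q_1v$ in $\mathbb{G}/G$. A morphism $t\colon\mathcal{A}\to\mathcal{A}'$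 yields $t_\oplus$: $(H,x)\mapsto(H,t_Hx)$, $[P,f]\mapsto[P,t_{p_2}^{-1}t_P(f)t_{p_1}]$. **$\mathcal{A}^\oplus$.** An object $x_\bullet$ of $\mathcal{A}^\oplus(G)$: objects $x_H\in\mathcal{A}(H)$ ("level $H$") for all $H\in\mathbb{G}/G$ and isomorphisms $x_s\colon x_H\to s^*x_K$ for $s\colon H\to K$ in $\mathbb{G}/G$ with underlying local equivalence, such that $x_{\mathrm{id}}=\mathrm{id}$, $x_{H_1\sqcup H_2}$ is identified with $(x_{H_1},x_{H_2})$ via $(x_{\mathrm{incl}_1},x_{\mathrm{incl}_2})$, $x_{ts}=s^*(x_t)x_s$, and $\alpha^*_{x_K}x_s=x_t$ for 2-cells $\alpha\colon s\Rightarrow t$ in $\mathbb{G}/G$. Morphisms: families $f_H\colon x_H\to y_H$ with $y_sf_H=s^*(f_K)x_s$. Restriction: $(j^*x)_{H'}=x_{j_!H'}$, etc. Induction along faithful $j\colon G'\to G$: $(j_*x')_L=(\nabla_L)_*(x'_{j^{\approx}L})$ for $L\in\mathbb{G}/G$, where $j^{\approx}L\subseteq j^*L=G'\times_GL$ is the union of the components on which $\mathrm{pr}_2$ is fully faithful, viewed over $G'$ via $\mathrm{pr}_1$, and $\nabla_L=\mathrm{pr}_2|\colon j^{\approx}L\to L$; similarly on morphisms; the coherence isomorphism of $j_*x'$ at $s\colon L\to L'$ is $(\nabla_L)_*(x'_{j^{\approx}s})$ followed by the base-change isomorphism $(\nabla_L)_*(j^{\approx}s)^*\cong s^*(\nabla_{L'})_*$,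 with $j^{\approx}s$ the restriction of $j^*s$. $\mathcal{A}^\oplus$ is a Mackey 2-functor with this induction. **Mark transformation.** $\mu_{\mathcal{A}}:=\varepsilon_{\oplus,\mathcal{A}^\oplus}\circ(\eta^\oplus_{\mathcal{A}})_\oplus\colon\mathcal{A}_\oplus\to\mathcal{A}^\oplus$, where: $\eta^\oplus_{\mathcal{A}}\colon\mathcal{A}\to\mathcal{A}^\oplus$ is given by $(\eta^\oplus_{\mathcal{A},G}(x))_H=\varsigma_H^*x$, $(\eta^\oplus_{\mathcal{A},G}(x))_s=(\varsigma_s)^*_x$ and $(\eta^\oplus_{\mathcal{A},G}(f))_H=\varsigma_H^*f$; and for a Mackey 2-functor $\mathcal{M}$, $\varepsilon_{\oplus,\mathcal{M}}\colon\mathcal{M}_\oplus\to\mathcal{M}$ sends $(H,x)$ to $(\varsigma_H)_*x$ and $[P,p_1,p_2;f]$ to $(\varsigma_H)_*x\xrightarrow{{}^r\eta}(\varsigma_H)_*p_{1*}p_1^*x\cong(\varsigma_P)_*p_1^*x\xrightarrow{(\varsigma_P)_*f}(\varsigma_P)_*p_2^*y\cong(\varsigma_K)_*p_{2*}p_2^*y\xrightarrow{{}^\ell\varepsilon}(\varsigma_K)_*y$. *)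

theory Defs
  imports "HOL-Algebra.FiniteProduct"
begin

section \<open>Categories, functors, natural transformations\<close>

record ('o, 'm) cat =
  Ob :: "'o set"
  Ar :: "'m set"
  Dom :: "'m \<Rightarrow> 'o"
  Cod :: "'m \<Rightarrow> 'o"
  Idn :: "'o \<Rightarrow> 'm"
  Cmp :: "'m \<Rightarrow> 'm \<Rightarrow> 'm"  (infixl "\<cdot>\<index>" 70)

text \<open>Composition is written in the usual order: \<open>g \<cdot>\<^bsub>C\<^esub> f\<close> is \<open>g\<close> after \<open>f\<close>.\<close>

definition Hom :: "('o, 'm, 'z) cat_scheme \<Rightarrow> 'o \<Rightarrow> 'o \<Rightarrow> 'm set" where
  "Hom C x y = {f \<in> Ar C. Dom C f = x \<and> Cod C f = y}"

definition category :: "('o, 'm, 'z) cat_scheme \<Rightarrow> bool" where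
  "category C \<longleftrightarrow>
     (\<forall>f\<in>Ar C. Dom C f \<in> Ob C \<and> Cod C f \<in> Ob C) \<and>
     (\<forall>x\<in>Ob C. Idn C x \<in> Hom C x x) \<and>
     (\<forall>x y z f g. f \<in> Hom C x y \<longrightarrow> g \<in> Hom C y z \<longrightarrow> g \<cdot>\<^bsub>C\<^esub> f \<in> Hom C x z) \<and>
     (\<forall>x y f. f \<in> Hom C x y \<longrightarrow> f \<cdot>\<^bsub>C\<^esub> Idn C x = f \<and> Idn C y \<cdot>\<^bsub>C\<^esub> f = f) \<and>
     (\<forall>w x y z f g h. f \<in> Hom C w x \<longrightarrow> g \<in> Hom C x y \<longrightarrow> h \<in> Hom C y z \<longrightarrow>
        h \<cdot>\<^bsub>C\<^esub> (g \<cdot>\<^bsub>C\<^esub> f) = (h \<cdot>\<^bsub>C\<^esub> g) \<cdot>\<^bsub>C\<^esub> f)"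

definition inverse_arrows :: "('o, 'm, 'z) cat_scheme \<Rightarrow> 'm \<Rightarrow> 'm \<Rightarrow> bool" where
  "inverse_arrows C f g \<longleftrightarrow> f \<in> Ar C \<and> g \<in> Hom C (Cod C f) (Dom C f) \<and>
     g \<cdot>\<^bsub>C\<^esub> f = Idn C (Dom C f) \<and> f \<cdot>\<^bsub>C\<^esub> g = Idn C (Cod C f)"

definition iso_arrow :: "('o, 'm, 'z) cat_scheme \<Rightarrow> 'm \<Rightarrow> bool" where
  "iso_arrow C f \<longleftrightarrow> (\<exists>g. inverse_arrows C f g)"

definition inv_arrow :: "('o, 'm, 'z) cat_scheme \<Rightarrow> 'm \<Rightarrow> 'm" where
  "inv_arrow C f = (THE g. inverse_arrows C f g)"

definition Iso :: "('o, 'm, 'z) cat_scheme \<Rightarrow> 'o \<Rightarrow> 'o \<Rightarrow> 'm set" where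
  "Iso C x y = {f \<in> Hom C x y. iso_arrow C f}"

record ('o, 'm, 'p, 'n) fctr =
  FO :: "'o \<Rightarrow> 'p"
  FA :: "'m \<Rightarrow> 'n"

definition is_functor ::
  "('o, 'm, 'y) cat_scheme \<Rightarrow> ('p, 'n, 'z) cat_scheme \<Rightarrow> ('o, 'm, 'p, 'n) fctr \<Rightarrow> bool" where
  "is_functor C D F \<longleftrightarrow>
     (\<forall>x\<in>Ob C. FO F x \<in> Ob D) \<and>
     (\<forall>x y f. f \<in> Hom C x y \<longrightarrow> FA F f \<in> Hom D (FO F x) (FO F y)) \<and>
     (\<forall>x\<in>Ob C. FA F (Idn C x) = Idn D (FO F x)) \<and>
     (\<forall>x y z f g. f \<in> Hom C x y \<longrightarrow> g \<in> Hom C y z \<longrightarrow> FA F (g \<cdot>\<^bsub>C\<^esub> f) = FA F g \<cdot>\<^bsub>D\<^esub> FA F f)"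

definition fid :: "('o, 'm, 'o, 'm) fctr" where
  "fid = \<lparr>FO = id, FA = id\<rparr>"

definition fcomp ::
  "('p, 'n, 'q, 'l) fctr \<Rightarrow> ('o, 'm, 'p, 'n) fctr \<Rightarrow> ('o, 'm, 'q, 'l) fctr" where
  "fcomp F' F = \<lparr>FO = FO F' \<circ> FO F, FA = FA F' \<circ> FA F\<rparr>"

definition frestr ::
  "('o, 'm, 'z) cat_scheme \<Rightarrow> ('o, 'm, 'p, 'n) fctr \<Rightarrow> ('o, 'm, 'p, 'n) fctr" where
  "frestr C F = \<lparr>FO = restrict (FO F) (Ob C), FA = restrict (FA F) (Ar C)\<rparr>"

definition nat_trans ::
  "('o, 'm, 'y) cat_scheme \<Rightarrow> ('p, 'n, 'z) cat_scheme \<Rightarrow>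
   ('o, 'm, 'p, 'n) fctr \<Rightarrow> ('o, 'm, 'p, 'n) fctr \<Rightarrow> ('o \<Rightarrow> 'n) \<Rightarrow> bool" where
  "nat_trans C D F F' \<tau> \<longleftrightarrow>
     (\<forall>x\<in>Ob C. \<tau> x \<in> Hom D (FO F x) (FO F' x)) \<and>
     (\<forall>f\<in>Ar C. \<tau> (Cod C f) \<cdot>\<^bsub>D\<^esub> FA F f = FA F' f \<cdot>\<^bsub>D\<^esub> \<tau> (Dom C f))"

definition faithful ::
  "('o, 'm, 'y) cat_scheme \<Rightarrow> ('o, 'm, 'p, 'n) fctr \<Rightarrow> bool" where
  "faithful C F \<longleftrightarrow> (\<forall>x\<in>Ob C. \<forall>y\<in>Ob C. inj_on (FA F) (Hom C x y))"

definition fully_faithful_on ::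
  "('o, 'm, 'y) cat_scheme \<Rightarrow> ('p, 'n, 'z) cat_scheme \<Rightarrow> ('o, 'm, 'p, 'n) fctr \<Rightarrow> 'o set \<Rightarrow> bool" where
  "fully_faithful_on C D F S \<longleftrightarrow>
     (\<forall>x\<in>S. \<forall>y\<in>S. bij_betw (FA F) (Hom C x y) (Hom D (FO F x) (FO F y)))"

definition equivalence ::
  "('o, 'm, 'y) cat_scheme \<Rightarrow> ('p, 'n, 'z) cat_scheme \<Rightarrow> ('o, 'm, 'p, 'n) fctr \<Rightarrow> bool" where
  "equivalence C D F \<longleftrightarrow> is_functor C D F \<and> fully_faithful_on C D F (Ob C) \<and>
     (\<forall>y\<in>Ob D. \<exists>x\<in>Ob C. Iso D (FO F x) y \<noteq> {})"

definition prod_cat ::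
  "('o, 'm, 'y) cat_scheme \<Rightarrow> ('p, 'n, 'z) cat_scheme \<Rightarrow> ('o \<times> 'p, 'm \<times> 'n) cat" where
  "prod_cat C D = \<lparr>Ob = Ob C \<times> Ob D, Ar = Ar C \<times> Ar D,
     Dom = map_prod (Dom C) (Dom D), Cod = map_prod (Cod C) (Cod D),
     Idn = map_prod (Idn C) (Idn D),
     Cmp = (\<lambda>g f. (fst g \<cdot>\<^bsub>C\<^esub> fst f, snd g \<cdot>\<^bsub>D\<^esub> snd f))\<rparr>"


section \<open>Additive categories and two-sided adjoints\<close>

record ('o, 'm) acat = "('o, 'm) cat" +
  Add :: "'m \<Rightarrow> 'm \<Rightarrow> 'm"
  Zro :: "'o \<Rightarrow> 'o \<Rightarrow> 'm"

definition hom_group :: "('o, 'm, 'z) acat_scheme \<Rightarrow> 'o \<Rightarrow> 'o \<Rightarrow> 'm monoid" where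
  "hom_group C x y = \<lparr>carrier = Hom C x y, mult = Add C, one = Zro C x y\<rparr>"

definition is_direct_sum ::
  "('o, 'm, 'z) acat_scheme \<Rightarrow> 'i set \<Rightarrow> ('i \<Rightarrow> 'o) \<Rightarrow> 'o \<Rightarrow> ('i \<Rightarrow> 'm) \<Rightarrow> ('i \<Rightarrow> 'm) \<Rightarrow> bool" where
  "is_direct_sum C I z d \<iota> \<pi> \<longleftrightarrow> finite I \<and> d \<in> Ob C \<and>
     (\<forall>i\<in>I. z i \<in> Ob C \<and> \<iota> i \<in> Hom C (z i) d \<and> \<pi> i \<in> Hom C d (z i)) \<and>
     (\<forall>i\<in>I. \<forall>j\<in>I. \<pi> j \<cdot>\<^bsub>C\<^esub> \<iota> i = (if i = j then Idn C (z i) else Zro C (z i) (z j))) \<and>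
     finprod (hom_group C d d) (\<lambda>i. \<iota> i \<cdot>\<^bsub>C\<^esub> \<pi> i) I = Idn C d"

definition additive_category :: "('o, 'm, 'z) acat_scheme \<Rightarrow> bool" where
  "additive_category C \<longleftrightarrow> category C \<and>
     (\<forall>x\<in>Ob C. \<forall>y\<in>Ob C. comm_group (hom_group C x y)) \<and>
     (\<forall>x y z f f' g g'. f \<in> Hom C x y \<longrightarrow> f' \<in> Hom C x y \<longrightarrow> g \<in> Hom C y z \<longrightarrow> g' \<in> Hom C y z \<longrightarrow>
        g \<cdot>\<^bsub>C\<^esub> Add C f f' = Add C (g \<cdot>\<^bsub>C\<^esub> f) (g \<cdot>\<^bsub>C\<^esub> f') \<and>
        Add C g g' \<cdot>\<^bsub>C\<^esub> f = Add C (g \<cdot>\<^bsub>C\<^esub> f) (g' \<cdot>\<^bsub>C\<^esub> f)) \<and>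
     (\<exists>d \<iota> \<pi>. is_direct_sum C ({} :: bool set) (\<lambda>_. d) d \<iota> \<pi>) \<and>
     (\<forall>x\<in>Ob C. \<forall>y\<in>Ob C. \<exists>d \<iota> \<pi>.
        is_direct_sum C (UNIV :: bool set) (\<lambda>b. if b then x else y) d \<iota> \<pi>)"

definition additive_functor ::
  "('o, 'm, 'y) acat_scheme \<Rightarrow> ('p, 'n, 'z) acat_scheme \<Rightarrow> ('o, 'm, 'p, 'n) fctr \<Rightarrow> bool" where
  "additive_functor C D F \<longleftrightarrow> is_functor C D F \<and>
     (\<forall>x y f g. f \<in> Hom C x y \<longrightarrow> g \<in> Hom C x y \<longrightarrow> FA F (Add C f g) = Add D (FA F f) (FA F g))"

text \<open>
  A functor \<open>Ind\<close> in the direction opposite to a given \<open>F\<close>, with units and counits: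
  \<open>Leta\<close>, \<open>Leps\<close> for \<open>Ind \<stileturn> F\<close> and \<open>Reta\<close>, \<open>Reps\<close> for \<open>F \<stileturn> Ind\<close>.
\<close>

record ('o, 'm) adj2 =
  Ind :: "('o, 'm, 'o, 'm) fctr"
  Leta :: "'o \<Rightarrow> 'm"
  Leps :: "'o \<Rightarrow> 'm"
  Reta :: "'o \<Rightarrow> 'm"
  Reps :: "'o \<Rightarrow> 'm"

definition two_sided_adjoint ::
  "('o, 'm, 'y) cat_scheme \<Rightarrow> ('o, 'm, 'z) cat_scheme \<Rightarrow> ('o, 'm, 'o, 'm) fctr \<Rightarrow> ('o, 'm) adj2 \<Rightarrow> bool" where
  "two_sided_adjoint D C F I \<longleftrightarrow>
     is_functor D C F \<and> is_functor C D (Ind I) \<and>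
     nat_trans C C fid (fcomp F (Ind I)) (Leta I) \<and>
     nat_trans D D (fcomp (Ind I) F) fid (Leps I) \<and>
     (\<forall>x\<in>Ob D. FA F (Leps I x) \<cdot>\<^bsub>C\<^esub> Leta I (FO F x) = Idn C (FO F x)) \<and>
     (\<forall>y\<in>Ob C. Leps I (FO (Ind I) y) \<cdot>\<^bsub>D\<^esub> FA (Ind I) (Leta I y) = Idn D (FO (Ind I) y)) \<and>
     nat_trans D D fid (fcomp (Ind I) F) (Reta I) \<and>
     nat_trans C C (fcomp F (Ind I)) fid (Reps I) \<and>
     (\<forall>x\<in>Ob D. Reps I (FO F x) \<cdot>\<^bsub>C\<^esub> FA F (Reta I x) = Idn C (FO F x)) \<and>
     (\<forall>y\<in>Ob C. FA (Ind I) (Reps I y) \<cdot>\<^bsub>D\<^esub> Reta I (FO (Ind I) y) = Idn D (FO (Ind I) y))"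


section \<open>Finite groupoids and the 2-category \<open>\<G>\<close>\<close>

text \<open>
  Finite groupoids have their objects and arrows in one type, which is closed under the
  formation of tuples (for isocommas) and tagged copies (for disjoint unions) and
  contains infinitely many elements, so every finite groupoid has an isomorphic copy in it.
\<close>

datatype 'a univ =
    Atom (unAtom: 'a)
  | Tup (entries: "'a univ list")
  | InL "'a univ"
  | InR "'a univ"

abbreviation ent :: "'a univ \<Rightarrow> nat \<Rightarrow> 'a univ" where
  "ent z n \<equiv> entries z ! n"

fun copair :: "('a univ \<Rightarrow> 'b) \<Rightarrow> ('a univ \<Rightarrow> 'b) \<Rightarrow> 'a univ \<Rightarrow> 'b" where
  "copair f g (InL z) = f z"
| "copair f g (InR z) = g z"
| "copair f g _ = undefined"

type_synonym 'a gpd = "('a univ, 'a univ) cat"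
type_synonym 'a gfun = "('a univ, 'a univ, 'a univ, 'a univ) fctr"

text \<open>
  All the data of groupoids, functors and 2-cells are extensional outside their domains, so that
  HOL equality of 1-morphisms and of 2-cells is equality of functors and of transformations.
\<close>

definition finite_groupoid :: "'a gpd \<Rightarrow> bool" where
  "finite_groupoid C \<longleftrightarrow> category C \<and> (\<forall>f\<in>Ar C. iso_arrow C f) \<and> finite (Ob C) \<and> finite (Ar C) \<and>
     Dom C \<in> extensional (Ar C) \<and> Cod C \<in> extensional (Ar C) \<and> Idn C \<in> extensional (Ob C) \<and>
     (\<forall>g f. \<not> (f \<in> Ar C \<and> g \<in> Ar C \<and> Dom C g = Cod C f) \<longrightarrow> g \<cdot>\<^bsub>C\<^esub> f = undefined)"

definition ext_functor :: "'a gpd \<Rightarrow> 'a gpd \<Rightarrow> 'a gfun \<Rightarrow> bool" where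
  "ext_functor C D F \<longleftrightarrow> is_functor C D F \<and> FO F \<in> extensional (Ob C) \<and> FA F \<in> extensional (Ar C)"

definition component :: "'a gpd \<Rightarrow> 'a univ \<Rightarrow> 'a univ set" where
  "component C a = {b \<in> Ob C. Hom C a b \<noteq> {}}"

definition components :: "'a gpd \<Rightarrow> 'a univ set set" where
  "components C = component C ` Ob C"

definition full_sub :: "'a gpd \<Rightarrow> 'a univ set \<Rightarrow> 'a gpd" where
  "full_sub C S =
     (let R = {f \<in> Ar C. Dom C f \<in> S \<and> Cod C f \<in> S} in
      \<lparr>Ob = Ob C \<inter> S, Ar = R, Dom = restrict (Dom C) R, Cod = restrict (Cod C) R,
       Idn = restrict (Idn C) (Ob C \<inter> S),
       Cmp = (\<lambda>g f. if f \<in> R \<and> g \<in> R then g \<cdot>\<^bsub>C\<^esub> f else undefined)\<rparr>)"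

definition disjoint_union :: "'a gpd \<Rightarrow> 'a gpd \<Rightarrow> 'a gpd" where
  "disjoint_union C D =
     (let U = InL ` Ob C \<union> InR ` Ob D; R = InL ` Ar C \<union> InR ` Ar D in
      \<lparr>Ob = U, Ar = R,
       Dom = restrict (copair (InL \<circ> Dom C) (InR \<circ> Dom D)) R,
       Cod = restrict (copair (InL \<circ> Cod C) (InR \<circ> Cod D)) R,
       Idn = restrict (copair (InL \<circ> Idn C) (InR \<circ> Idn D)) U,
       Cmp = (\<lambda>g f. case (g, f) of
           (InL g', InL f') \<Rightarrow>
             if f' \<in> Ar C \<and> g' \<in> Ar C \<and> Dom C g' = Cod C f' then InL (g' \<cdot>\<^bsub>C\<^esub> f') else undefined
         | (InR g', InR f') \<Rightarrow>
             if f' \<in> Ar D \<and> g' \<in> Ar D \<and> Dom D g' = Cod D f' then InR (g' \<cdot>\<^bsub>D\<^esub> f') else undefined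
         | _ \<Rightarrow> undefined)\<rparr>)"

text \<open>A group as a groupoid with one object.\<close>

definition deloop :: "'a monoid \<Rightarrow> 'a gpd" where
  "deloop \<Gamma> =
     (let R = Atom ` carrier \<Gamma>; pt = Atom \<one>\<^bsub>\<Gamma>\<^esub> in
      \<lparr>Ob = {pt}, Ar = R, Dom = (\<lambda>_\<in>R. pt), Cod = (\<lambda>_\<in>R. pt), Idn = (\<lambda>_\<in>{pt}. Atom \<one>\<^bsub>\<Gamma>\<^esub>),
       Cmp = (\<lambda>g f. if f \<in> R \<and> g \<in> R then Atom (unAtom g \<otimes>\<^bsub>\<Gamma>\<^esub> unAtom f) else undefined)\<rparr>)"

text \<open>
  The three choices of the 2-category \<open>\<G>\<close>: finite groupoids, finite groupoids with faithful
  functors, and finite groupoids faithful over a finite group.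
\<close>

datatype 'a ambient = Gpd | GpdF | GpdFOver "'a monoid"

definition is_ambient :: "'a ambient \<Rightarrow> bool" where
  "is_ambient \<G> \<longleftrightarrow> (case \<G> of GpdFOver \<Gamma> \<Rightarrow> group \<Gamma> \<and> finite (carrier \<Gamma>) | _ \<Rightarrow> True)"

definition base :: "'a ambient \<Rightarrow> 'a gpd" where
  "base \<G> = (case \<G> of GpdFOver \<Gamma> \<Rightarrow> deloop \<Gamma> | _ \<Rightarrow> undefined)"

text \<open>
  The functor \<open>Str\<close> to the group, and the comparison isomorphism \<open>Tw u : Str H \<Rightarrow> Str G \<circ> u\<close>
  of a 1-morphism \<open>u : H \<rightarrow> G\<close>, are present only over a group.
\<close>

record 'a gobj =
  Und :: "'a gpd"
  Str :: "'a gfun option"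

record 'a gmor =
  Src :: "'a gobj"
  Tgt :: "'a gobj"
  Fn :: "'a gfun"
  Tw :: "('a univ \<Rightarrow> 'a univ) option"

record 'a gcell =
  CSrc :: "'a gmor"
  CTgt :: "'a gmor"
  Cp :: "'a univ \<Rightarrow> 'a univ"

definition is_obj :: "'a ambient \<Rightarrow> 'a gobj \<Rightarrow> bool" where
  "is_obj \<G> X \<longleftrightarrow> finite_groupoid (Und X) \<and>
     (case \<G> of
        GpdFOver \<Gamma> \<Rightarrow> \<exists>p. Str X = Some p \<and> ext_functor (Und X) (deloop \<Gamma>) p \<and> faithful (Und X) p
      | _ \<Rightarrow> Str X = None)"

definition is_mor :: "'a ambient \<Rightarrow> 'a gmor \<Rightarrow> bool" where
  "is_mor \<G> u \<longleftrightarrow> is_obj \<G> (Src u) \<and> is_obj \<G> (Tgt u) \<and>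
     ext_functor (Und (Src u)) (Und (Tgt u)) (Fn u) \<and>
     (case \<G> of
        Gpd \<Rightarrow> Tw u = None
      | GpdF \<Rightarrow> Tw u = None \<and> faithful (Und (Src u)) (Fn u)
      | GpdFOver \<Gamma> \<Rightarrow> \<exists>\<theta>. Tw u = Some \<theta> \<and> \<theta> \<in> extensional (Ob (Und (Src u))) \<and>
          nat_trans (Und (Src u)) (deloop \<Gamma>) (the (Str (Src u))) (fcomp (the (Str (Tgt u))) (Fn u)) \<theta>)"

definition is_cell :: "'a ambient \<Rightarrow> 'a gcell \<Rightarrow> bool" where
  "is_cell \<G> \<alpha> \<longleftrightarrow> is_mor \<G> (CSrc \<alpha>) \<and> is_mor \<G> (CTgt \<alpha>) \<and>
     Src (CSrc \<alpha>) = Src (CTgt \<alpha>) \<and> Tgt (CSrc \<alpha>) = Tgt (CTgt \<alpha>) \<and>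
     Cp \<alpha> \<in> extensional (Ob (Und (Src (CSrc \<alpha>)))) \<and>
     nat_trans (Und (Src (CSrc \<alpha>))) (Und (Tgt (CSrc \<alpha>))) (Fn (CSrc \<alpha>)) (Fn (CTgt \<alpha>)) (Cp \<alpha>) \<and>
     (case \<G> of
        GpdFOver \<Gamma> \<Rightarrow> \<forall>a\<in>Ob (Und (Src (CSrc \<alpha>))).
          the (Tw (CTgt \<alpha>)) a =
          FA (the (Str (Tgt (CSrc \<alpha>)))) (Cp \<alpha> a) \<cdot>\<^bsub>deloop \<Gamma>\<^esub> the (Tw (CSrc \<alpha>)) a
      | _ \<Rightarrow> True)"

text \<open>1-morphisms that commute strictly with the functors to the group.\<close>

definition strict_mor :: "'a ambient \<Rightarrow> 'a gobj \<Rightarrow> 'a gobj \<Rightarrow> 'a gfun \<Rightarrow> 'a gmor" where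
  "strict_mor \<G> X Y F = \<lparr>Src = X, Tgt = Y, Fn = frestr (Und X) F,
     Tw = map_option (\<lambda>p. \<lambda>a\<in>Ob (Und X). Idn (base \<G>) (FO p a)) (Str X)\<rparr>"

definition gid :: "'a ambient \<Rightarrow> 'a gobj \<Rightarrow> 'a gmor" where
  "gid \<G> X = strict_mor \<G> X X fid"

definition gcomp :: "'a ambient \<Rightarrow> 'a gmor \<Rightarrow> 'a gmor \<Rightarrow> 'a gmor" where
  "gcomp \<G> v u = \<lparr>Src = Src u, Tgt = Tgt v, Fn = frestr (Und (Src u)) (fcomp (Fn v) (Fn u)),
     Tw = (case (Tw v, Tw u) of
         (Some \<psi>, Some \<theta>) \<Rightarrow> Some (\<lambda>a\<in>Ob (Und (Src u)). \<psi> (FO (Fn u) a) \<cdot>\<^bsub>base \<G>\<^esub> \<theta> a)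
       | _ \<Rightarrow> None)\<rparr>"

definition cid :: "'a gmor \<Rightarrow> 'a gcell" where
  "cid u = \<lparr>CSrc = u, CTgt = u, Cp = (\<lambda>a\<in>Ob (Und (Src u)). Idn (Und (Tgt u)) (FO (Fn u) a))\<rparr>"

definition vcomp :: "'a gcell \<Rightarrow> 'a gcell \<Rightarrow> 'a gcell" where
  "vcomp \<beta> \<alpha> = \<lparr>CSrc = CSrc \<alpha>, CTgt = CTgt \<beta>,
     Cp = (\<lambda>a\<in>Ob (Und (Src (CSrc \<alpha>))). Cp \<beta> a \<cdot>\<^bsub>Und (Tgt (CSrc \<alpha>))\<^esub> Cp \<alpha> a)\<rparr>"

definition cinv :: "'a gcell \<Rightarrow> 'a gcell" where
  "cinv \<alpha> = \<lparr>CSrc = CTgt \<alpha>, CTgt = CSrc \<alpha>,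
     Cp = (\<lambda>a\<in>Ob (Und (Src (CSrc \<alpha>))). inv_arrow (Und (Tgt (CSrc \<alpha>))) (Cp \<alpha> a))\<rparr>"

definition lwhisk :: "'a ambient \<Rightarrow> 'a gmor \<Rightarrow> 'a gcell \<Rightarrow> 'a gcell" where
  "lwhisk \<G> v \<alpha> = \<lparr>CSrc = gcomp \<G> v (CSrc \<alpha>), CTgt = gcomp \<G> v (CTgt \<alpha>),
     Cp = (\<lambda>a\<in>Ob (Und (Src (CSrc \<alpha>))). FA (Fn v) (Cp \<alpha> a))\<rparr>"

definition rwhisk :: "'a ambient \<Rightarrow> 'a gcell \<Rightarrow> 'a gmor \<Rightarrow> 'a gcell" where
  "rwhisk \<G> \<alpha> v = \<lparr>CSrc = gcomp \<G> (CSrc \<alpha>) v, CTgt = gcomp \<G> (CTgt \<alpha>) v,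
     Cp = (\<lambda>a\<in>Ob (Und (Src v)). Cp \<alpha> (FO (Fn v) a))\<rparr>"

definition sub :: "'a gobj \<Rightarrow> 'a univ set \<Rightarrow> 'a gobj" where
  "sub X S = \<lparr>Und = full_sub (Und X) S, Str = map_option (frestr (full_sub (Und X) S)) (Str X)\<rparr>"

definition incl :: "'a ambient \<Rightarrow> 'a gobj \<Rightarrow> 'a univ set \<Rightarrow> 'a gmor" where
  "incl \<G> X S = strict_mor \<G> (sub X S) X fid"

definition coprod :: "'a gobj \<Rightarrow> 'a gobj \<Rightarrow> 'a gobj" where
  "coprod X Y = \<lparr>Und = disjoint_union (Und X) (Und Y),
     Str = (case (Str X, Str Y) of
         (Some p, Some q) \<Rightarrow> Some (frestr (disjoint_union (Und X) (Und Y))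
            \<lparr>FO = copair (FO p) (FO q), FA = copair (FA p) (FA q)\<rparr>)
       | _ \<Rightarrow> None)\<rparr>"

definition incl1 :: "'a ambient \<Rightarrow> 'a gobj \<Rightarrow> 'a gobj \<Rightarrow> 'a gmor" where
  "incl1 \<G> X Y = strict_mor \<G> X (coprod X Y) \<lparr>FO = InL, FA = InL\<rparr>"

definition incl2 :: "'a ambient \<Rightarrow> 'a gobj \<Rightarrow> 'a gobj \<Rightarrow> 'a gmor" where
  "incl2 \<G> X Y = strict_mor \<G> Y (coprod X Y) \<lparr>FO = InR, FA = InR\<rparr>"


section \<open>Isocommas and Mackey squares\<close>

text \<open>
  Objects are \<open>Tup [a, b, g]\<close>; an arrow \<open>(h, k)\<close> from \<open>z\<close> to \<open>z'\<close> is \<open>Tup [z, z', h, k]\<close>.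
\<close>

definition isocomma_gpd :: "'a gmor \<Rightarrow> 'a gmor \<Rightarrow> 'a gpd" where
  "isocomma_gpd i u =
     (let H = Und (Src i); K = Und (Src u); G = Und (Tgt i);
          U = {Tup [a, b, g] | a b g. a \<in> Ob H \<and> b \<in> Ob K \<and> g \<in> Hom G (FO (Fn i) a) (FO (Fn u) b)};
          R = {Tup [z, z', h, k] | z z' h k. z \<in> U \<and> z' \<in> U \<and>
                 h \<in> Hom H (ent z 0) (ent z' 0) \<and> k \<in> Hom K (ent z 1) (ent z' 1) \<and>
                 ent z' 2 \<cdot>\<^bsub>G\<^esub> FA (Fn i) h = FA (Fn u) k \<cdot>\<^bsub>G\<^esub> ent z 2} in
      \<lparr>Ob = U, Ar = R, Dom = (\<lambda>m\<in>R. ent m 0), Cod = (\<lambda>m\<in>R. ent m 1),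
       Idn = (\<lambda>z\<in>U. Tup [z, z, Idn H (ent z 0), Idn K (ent z 1)]),
       Cmp = (\<lambda>n m. if m \<in> R \<and> n \<in> R \<and> ent n 0 = ent m 1
                then Tup [ent m 0, ent n 1, ent n 2 \<cdot>\<^bsub>H\<^esub> ent m 2, ent n 3 \<cdot>\<^bsub>K\<^esub> ent m 3]
                else undefined)\<rparr>)"

definition pr1_fun :: "'a gfun" where
  "pr1_fun = \<lparr>FO = (\<lambda>z. ent z 0), FA = (\<lambda>m. ent m 2)\<rparr>"

definition pr2_fun :: "'a gfun" where
  "pr2_fun = \<lparr>FO = (\<lambda>z. ent z 1), FA = (\<lambda>m. ent m 3)\<rparr>"

text \<open>
  Over a group, the isocomma maps to the group through \<open>pr1\<close>, and \<open>pr2\<close> is compared with it by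
  \<open>p\<^sub>H a \<rightarrow> p\<^sub>G (i a) \<rightarrow> p\<^sub>G (u b) \<rightarrow> p\<^sub>K b\<close>, where the middle arrow is \<open>p\<^sub>G g\<close>; this makes
  the canonical transformation \<open>i pr1 \<Rightarrow> u pr2\<close> a 2-cell of \<open>\<G>\<close>.
\<close>

definition isocomma :: "'a gmor \<Rightarrow> 'a gmor \<Rightarrow> 'a gobj" where
  "isocomma i u = \<lparr>Und = isocomma_gpd i u,
     Str = map_option (\<lambda>p. frestr (isocomma_gpd i u) (fcomp p pr1_fun)) (Str (Src i))\<rparr>"

definition pr1 :: "'a ambient \<Rightarrow> 'a gmor \<Rightarrow> 'a gmor \<Rightarrow> 'a gmor" where
  "pr1 \<G> i u = strict_mor \<G> (isocomma i u) (Src i) pr1_fun"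

definition pr2 :: "'a ambient \<Rightarrow> 'a gmor \<Rightarrow> 'a gmor \<Rightarrow> 'a gmor" where
  "pr2 \<G> i u = \<lparr>Src = isocomma i u, Tgt = Src u, Fn = frestr (isocomma_gpd i u) pr2_fun,
     Tw = (case (Tw i, Tw u, Str (Tgt i)) of
         (Some \<theta>, Some \<psi>, Some p) \<Rightarrow> Some (\<lambda>z\<in>Ob (isocomma_gpd i u).
            inv_arrow (base \<G>) (\<psi> (ent z 1)) \<cdot>\<^bsub>base \<G>\<^esub> FA p (ent z 2) \<cdot>\<^bsub>base \<G>\<^esub> \<theta> (ent z 0))
       | _ \<Rightarrow> None)\<rparr>"

definition mackey_square ::
  "'a ambient \<Rightarrow> 'a gmor \<Rightarrow> 'a gmor \<Rightarrow> 'a gmor \<Rightarrow> 'a gmor \<Rightarrow> 'a gcell \<Rightarrow> bool" where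
  "mackey_square \<G> i u v j \<gamma> \<longleftrightarrow>
     is_mor \<G> i \<and> is_mor \<G> u \<and> is_mor \<G> v \<and> is_mor \<G> j \<and>
     Tgt i = Tgt u \<and> Tgt v = Src i \<and> Tgt j = Src u \<and> Src v = Src j \<and>
     is_cell \<G> \<gamma> \<and> CSrc \<gamma> = gcomp \<G> i v \<and> CTgt \<gamma> = gcomp \<G> u j \<and>
     equivalence (Und (Src v)) (isocomma_gpd i u)
       (let E = (\<lambda>a. Tup [FO (Fn v) a, FO (Fn j) a, Cp \<gamma> a]) in
        \<lparr>FO = E, FA = (\<lambda>m. Tup [E (Dom (Und (Src v)) m), E (Cod (Und (Src v)) m),
                                FA (Fn v) m, FA (Fn j) m])\<rparr>)"


section \<open>Restriction 2-functors and Mackey 2-functors\<close>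

record ('a, 'o, 'm) rfun =
  Cat :: "'a gobj \<Rightarrow> ('o, 'm) acat"
  Res :: "'a gmor \<Rightarrow> ('o, 'm, 'o, 'm) fctr"
  ResC :: "'a gcell \<Rightarrow> 'o \<Rightarrow> 'm"

definition restriction_2functor :: "'a ambient \<Rightarrow> ('a, 'o, 'm) rfun \<Rightarrow> bool" where
  "restriction_2functor \<G> \<A> \<longleftrightarrow>
     (\<forall>X. is_obj \<G> X \<longrightarrow> additive_category (Cat \<A> X)) \<and>
     (\<forall>u. is_mor \<G> u \<longrightarrow> additive_functor (Cat \<A> (Tgt u)) (Cat \<A> (Src u)) (Res \<A> u)) \<and>
     (\<forall>\<alpha>. is_cell \<G> \<alpha> \<longrightarrow> nat_trans (Cat \<A> (Tgt (CSrc \<alpha>))) (Cat \<A> (Src (CSrc \<alpha>)))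
        (Res \<A> (CSrc \<alpha>)) (Res \<A> (CTgt \<alpha>)) (ResC \<A> \<alpha>)) \<and>
     (\<forall>X. is_obj \<G> X \<longrightarrow>
        (\<forall>x\<in>Ob (Cat \<A> X). FO (Res \<A> (gid \<G> X)) x = x) \<and>
        (\<forall>f\<in>Ar (Cat \<A> X). FA (Res \<A> (gid \<G> X)) f = f)) \<and>
     (\<forall>v u. is_mor \<G> v \<longrightarrow> is_mor \<G> u \<longrightarrow> Tgt u = Src v \<longrightarrow>
        (\<forall>x\<in>Ob (Cat \<A> (Tgt v)). FO (Res \<A> (gcomp \<G> v u)) x = FO (Res \<A> u) (FO (Res \<A> v) x)) \<and>
        (\<forall>f\<in>Ar (Cat \<A> (Tgt v)). FA (Res \<A> (gcomp \<G> v u)) f = FA (Res \<A> u) (FA (Res \<A> v) f))) \<and>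
     (\<forall>u. is_mor \<G> u \<longrightarrow> (\<forall>x\<in>Ob (Cat \<A> (Tgt u)).
        ResC \<A> (cid u) x = Idn (Cat \<A> (Src u)) (FO (Res \<A> u) x))) \<and>
     (\<forall>\<beta> \<alpha>. is_cell \<G> \<beta> \<longrightarrow> is_cell \<G> \<alpha> \<longrightarrow> CTgt \<alpha> = CSrc \<beta> \<longrightarrow>
        (\<forall>x\<in>Ob (Cat \<A> (Tgt (CSrc \<alpha>))).
           ResC \<A> (vcomp \<beta> \<alpha>) x = ResC \<A> \<beta> x \<cdot>\<^bsub>Cat \<A> (Src (CSrc \<alpha>))\<^esub> ResC \<A> \<alpha> x)) \<and>
     (\<forall>v \<alpha>. is_mor \<G> v \<longrightarrow> is_cell \<G> \<alpha> \<longrightarrow> Tgt (CSrc \<alpha>) = Src v \<longrightarrow>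
        (\<forall>x\<in>Ob (Cat \<A> (Tgt v)). ResC \<A> (lwhisk \<G> v \<alpha>) x = ResC \<A> \<alpha> (FO (Res \<A> v) x))) \<and>
     (\<forall>\<alpha> v. is_cell \<G> \<alpha> \<longrightarrow> is_mor \<G> v \<longrightarrow> Tgt v = Src (CSrc \<alpha>) \<longrightarrow>
        (\<forall>x\<in>Ob (Cat \<A> (Tgt (CSrc \<alpha>))). ResC \<A> (rwhisk \<G> \<alpha> v) x = FA (Res \<A> v) (ResC \<A> \<alpha> x))) \<and>
     (\<forall>X Y. is_obj \<G> X \<longrightarrow> is_obj \<G> Y \<longrightarrow>
        equivalence (Cat \<A> (coprod X Y)) (prod_cat (Cat \<A> X) (Cat \<A> Y))
          \<lparr>FO = (\<lambda>x. (FO (Res \<A> (incl1 \<G> X Y)) x, FO (Res \<A> (incl2 \<G> X Y)) x)),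
           FA = (\<lambda>f. (FA (Res \<A> (incl1 \<G> X Y)) f, FA (Res \<A> (incl2 \<G> X Y)) f))\<rparr>)"

definition faithful_mor :: "'a gmor \<Rightarrow> bool" where
  "faithful_mor i \<longleftrightarrow> faithful (Und (Src i)) (Fn i)"

text \<open>\<open>\<I> i\<close> is \<open>i\<^sub>*\<close> with its units and counits; only its values at faithful \<open>i\<close> matter.\<close>

definition mackey_2functor ::
  "'a ambient \<Rightarrow> ('a, 'o, 'm) rfun \<Rightarrow> ('a gmor \<Rightarrow> ('o, 'm) adj2) \<Rightarrow> bool" where
  "mackey_2functor \<G> \<M> \<I> \<longleftrightarrow> restriction_2functor \<G> \<M> \<and>
     (\<forall>i. is_mor \<G> i \<longrightarrow> faithful_mor i \<longrightarrow>
        two_sided_adjoint (Cat \<M> (Tgt i)) (Cat \<M> (Src i)) (Res \<M> i) (\<I> i) \<and>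
        (\<forall>y\<in>Ob (Cat \<M> (Src i)). Reps (\<I> i) y \<cdot>\<^bsub>Cat \<M> (Src i)\<^esub> Leta (\<I> i) y = Idn (Cat \<M> (Src i)) y)) \<and>
     (\<forall>i u v j \<gamma>. mackey_square \<G> i u v j \<gamma> \<longrightarrow> faithful_mor i \<longrightarrow> faithful_mor j \<longrightarrow>
        (\<forall>y\<in>Ob (Cat \<M> (Src i)).
           let D = Cat \<M> (Src u); E = Cat \<M> (Src v);
               iy = FO (Ind (\<I> i)) y; uiy = FO (Res \<M> u) iy in
           iso_arrow D (Leps (\<I> j) uiy \<cdot>\<^bsub>D\<^esub>
             FA (Ind (\<I> j)) (ResC \<M> \<gamma> iy \<cdot>\<^bsub>E\<^esub> FA (Res \<M> v) (Leta (\<I> i) y))) \<and>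
           iso_arrow D (FA (Ind (\<I> j)) (FA (Res \<M> v) (Reps (\<I> i) y) \<cdot>\<^bsub>E\<^esub> ResC \<M> (cinv \<gamma>) iy) \<cdot>\<^bsub>D\<^esub>
             Reta (\<I> j) uiy)))"

text \<open>
  The components of a morphism \<open>t\<close> of restriction 2-functors:
  \<open>TrF t G = t\<^sub>G\<close>, and \<open>TrN t u x : u\<^sup>* (t\<^sub>G x) \<rightarrow> t\<^sub>H (u\<^sup>* x)\<close> for \<open>u : H \<rightarrow> G\<close>.
\<close>

record ('a, 'o, 'm, 'p, 'n) rtrans =
  TrF :: "'a gobj \<Rightarrow> ('o, 'm, 'p, 'n) fctr"
  TrN :: "'a gmor \<Rightarrow> 'o \<Rightarrow> 'n"


section \<open>Local equivalences, folding induction, trace\<close>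

definition ff_part :: "'a gmor \<Rightarrow> 'a univ set" where
  "ff_part u = \<Union>{M \<in> components (Und (Src u)).
     fully_faithful_on (Und (Src u)) (Und (Tgt u)) (Fn u) M}"

definition local_equivalence :: "'a gmor \<Rightarrow> bool" where
  "local_equivalence s \<longleftrightarrow> (\<forall>M\<in>components (Und (Src s)).
     fully_faithful_on (Und (Src s)) (Und (Tgt s)) (Fn s) M)"

definition comp_image :: "'a gmor \<Rightarrow> 'a univ set \<Rightarrow> 'a univ set" where
  "comp_image s M = (\<Union>a\<in>M. component (Und (Tgt s)) (FO (Fn s) a))"

definition mor_restrict :: "'a gmor \<Rightarrow> 'a univ set \<Rightarrow> 'a univ set \<Rightarrow> 'a gmor" where
  "mor_restrict s M L = \<lparr>Src = sub (Src s) M, Tgt = sub (Tgt s) L,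
     Fn = frestr (full_sub (Und (Src s)) M) (Fn s),
     Tw = map_option (\<lambda>\<theta>. restrict \<theta> (Ob (Und (Src s)) \<inter> M)) (Tw s)\<rparr>"

text \<open>
  \<open>I\<close> is folding induction along \<open>s\<close>: at a component \<open>L\<close> of the target, \<open>s\<^sub>* y\<close> is the direct sum,
  over the components \<open>M\<close> mapped to \<open>L\<close>, of objects \<open>z M = ((s|M)\<^sup>*)\<^sup>-\<^sup>1 (y M)\<close>, that is objects
  with an isomorphism \<open>\<phi> M\<close> from \<open>(s|M)\<^sup>* (z M)\<close> to \<open>y M\<close>.
  The unit \<open>Leta\<close> is given by the summand inclusions and the counit \<open>Reps\<close> by the summand projections;
  the triangle identities then determine \<open>Leps\<close>, \<open>Reta\<close> and the action of \<open>s\<^sub>*\<close> on morphisms.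
\<close>

definition is_folding_induction ::
  "'a ambient \<Rightarrow> ('a, 'o, 'm) rfun \<Rightarrow> 'a gmor \<Rightarrow> ('o, 'm) adj2 \<Rightarrow> bool" where
  "is_folding_induction \<G> \<A> s I \<longleftrightarrow>
     two_sided_adjoint (Cat \<A> (Tgt s)) (Cat \<A> (Src s)) (Res \<A> s) I \<and>
     (\<forall>y\<in>Ob (Cat \<A> (Src s)). \<exists>z \<iota> \<pi> \<phi>.
        (\<forall>L\<in>components (Und (Tgt s)).
           is_direct_sum (Cat \<A> (sub (Tgt s) L)) {M \<in> components (Und (Src s)). comp_image s M = L} z
             (FO (Res \<A> (incl \<G> (Tgt s) L)) (FO (Ind I) y)) \<iota> \<pi>) \<and>
        (\<forall>M\<in>components (Und (Src s)).
           let C = Cat \<A> (sub (Src s) M); sM = mor_restrict s M (comp_image s M);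
               inM = incl \<G> (Src s) M in
           \<phi> M \<in> Iso C (FO (Res \<A> sM) (z M)) (FO (Res \<A> inM) y) \<and>
           FA (Res \<A> inM) (Leta I y) = FA (Res \<A> sM) (\<iota> M) \<cdot>\<^bsub>C\<^esub> inv_arrow C (\<phi> M) \<and>
           FA (Res \<A> inM) (Reps I y) = \<phi> M \<cdot>\<^bsub>C\<^esub> FA (Res \<A> sM) (\<pi> M)))"

text \<open>
  The direct sums and the inverse equivalences in the formula for \<open>s\<^sub>*\<close> involve choices; they are
  fixed once and for all.
\<close>

definition folding_ind :: "'a ambient \<Rightarrow> ('a, 'o, 'm) rfun \<Rightarrow> 'a gmor \<Rightarrow> ('o, 'm) adj2" where
  "folding_ind \<G> \<A> s = (SOME I. is_folding_induction \<G> \<A> s I)"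

text \<open>The trace of \<open>f : s\<^sup>* c1 \<rightarrow> s\<^sup>* c2\<close>.\<close>

definition trace :: "'a ambient \<Rightarrow> ('a, 'o, 'm) rfun \<Rightarrow> 'a gmor \<Rightarrow> 'o \<Rightarrow> 'o \<Rightarrow> 'm \<Rightarrow> 'm" where
  "trace \<G> \<A> s c1 c2 f =
     (let I = folding_ind \<G> \<A> s; D = Cat \<A> (Tgt s) in
      Leps I c2 \<cdot>\<^bsub>D\<^esub> FA (Ind I) f \<cdot>\<^bsub>D\<^esub> Reta I c1)"


section \<open>Comma 2-categories\<close>

text \<open>
  An object \<open>H\<close> of \<open>\<G>/G\<close> is represented by its structure morphism \<open>\<sigma> : H \<rightarrow> G\<close>, with \<open>H = Src \<sigma>\<close>.
\<close>

definition over :: "'a ambient \<Rightarrow> 'a gobj \<Rightarrow> 'a gmor set" where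
  "over \<G> G = {\<sigma>. is_mor \<G> \<sigma> \<and> Tgt \<sigma> = G}"

definition over_faithful :: "'a ambient \<Rightarrow> 'a gobj \<Rightarrow> 'a gmor set" where
  "over_faithful \<G> G = {\<sigma> \<in> over \<G> G. faithful_mor \<sigma>}"

record 'a omor =
  OSrc :: "'a gmor"
  OTgt :: "'a gmor"
  OMor :: "'a gmor"
  OCell :: "'a gcell"

definition is_omor :: "'a ambient \<Rightarrow> 'a gobj \<Rightarrow> 'a omor \<Rightarrow> bool" where
  "is_omor \<G> G f \<longleftrightarrow> OSrc f \<in> over \<G> G \<and> OTgt f \<in> over \<G> G \<and>
     is_mor \<G> (OMor f) \<and> Src (OMor f) = Src (OSrc f) \<and> Tgt (OMor f) = Src (OTgt f) \<and>
     is_cell \<G> (OCell f) \<and> CSrc (OCell f) = OSrc f \<and> CTgt (OCell f) = gcomp \<G> (OTgt f) (OMor f)"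

definition is_ocell :: "'a ambient \<Rightarrow> 'a gobj \<Rightarrow> 'a omor \<Rightarrow> 'a omor \<Rightarrow> 'a gcell \<Rightarrow> bool" where
  "is_ocell \<G> G f f' \<alpha> \<longleftrightarrow> is_omor \<G> G f \<and> is_omor \<G> G f' \<and> OSrc f = OSrc f' \<and> OTgt f = OTgt f' \<and>
     is_cell \<G> \<alpha> \<and> CSrc \<alpha> = OMor f \<and> CTgt \<alpha> = OMor f' \<and>
     vcomp (lwhisk \<G> (OTgt f) \<alpha>) (OCell f) = OCell f'"

definition oid :: "'a ambient \<Rightarrow> 'a gmor \<Rightarrow> 'a omor" where
  "oid \<G> \<sigma> = \<lparr>OSrc = \<sigma>, OTgt = \<sigma>, OMor = gid \<G> (Src \<sigma>), OCell = cid \<sigma>\<rparr>"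

definition ocomp :: "'a ambient \<Rightarrow> 'a omor \<Rightarrow> 'a omor \<Rightarrow> 'a omor" where
  "ocomp \<G> t s = \<lparr>OSrc = OSrc s, OTgt = OTgt t, OMor = gcomp \<G> (OMor t) (OMor s),
     OCell = vcomp (rwhisk \<G> (OCell t) (OMor s)) (OCell s)\<rparr>"

definition local_omors :: "'a ambient \<Rightarrow> 'a gobj \<Rightarrow> 'a omor set" where
  "local_omors \<G> G = {s. is_omor \<G> G s \<and> local_equivalence (OMor s)}"

text \<open>On objects \<open>\<sigma>\<close>, the 2-functor \<open>j\<^sub>!\<close> is \<open>gcomp \<G> j\<close>.\<close>

definition shriek_mor :: "'a ambient \<Rightarrow> 'a gmor \<Rightarrow> 'a omor \<Rightarrow> 'a omor" where
  "shriek_mor \<G> j s = \<lparr>OSrc = gcomp \<G> j (OSrc s), OTgt = gcomp \<G> j (OTgt s), OMor = OMor s,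
     OCell = lwhisk \<G> j (OCell s)\<rparr>"

text \<open>
  \<open>pull_ff \<G> j \<sigma>\<close> is the part \<open>j\<^sup>\<approx> L\<close> of \<open>j\<^sup>* L = (j/\<sigma>)\<close> on which \<open>pr2\<close> is componentwise fully faithful,
  with its structure morphism to the source of \<open>j\<close>; \<open>nabla \<G> j \<sigma>\<close> is its projection to \<open>L = Src \<sigma>\<close>.
\<close>

definition pull_ff :: "'a ambient \<Rightarrow> 'a gmor \<Rightarrow> 'a gmor \<Rightarrow> 'a gmor" where
  "pull_ff \<G> j \<sigma> = gcomp \<G> (pr1 \<G> j \<sigma>) (incl \<G> (isocomma j \<sigma>) (ff_part (pr2 \<G> j \<sigma>)))"

definition nabla :: "'a ambient \<Rightarrow> 'a gmor \<Rightarrow> 'a gmor \<Rightarrow> 'a gmor" where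
  "nabla \<G> j \<sigma> = gcomp \<G> (pr2 \<G> j \<sigma>) (incl \<G> (isocomma j \<sigma>) (ff_part (pr2 \<G> j \<sigma>)))"

definition pull_ff_mor :: "'a ambient \<Rightarrow> 'a gmor \<Rightarrow> 'a omor \<Rightarrow> 'a omor" where
  "pull_ff_mor \<G> j s =
     (let P = pull_ff \<G> j (OSrc s); P' = pull_ff \<G> j (OTgt s); G = Und (Tgt j);
          f = Fn (OMor s);
          E = (\<lambda>z. Tup [ent z 0, FO f (ent z 1), Cp (OCell s) (ent z 1) \<cdot>\<^bsub>G\<^esub> ent z 2]) in
      \<lparr>OSrc = P, OTgt = P',
       OMor = strict_mor \<G> (Src P) (Src P')
         \<lparr>FO = E, FA = (\<lambda>m. Tup [E (ent m 0), E (ent m 1), ent m 2, FA f (ent m 3)])\<rparr>,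
       OCell = cid P\<rparr>)"


section \<open>The category \<open>\<A>\<^sub>\<oplus>(G)\<close>\<close>

record ('a, 'm) span =
  Leg1 :: "'a omor"
  Leg2 :: "'a omor"
  SMor :: "'m"

type_synonym ('a, 'o) pobj = "'a gmor \<times> 'o"
type_synonym ('a, 'o, 'm) parr = "('a, 'o) pobj \<times> ('a, 'o) pobj \<times> ('a, 'm) span set"

definition is_span ::
  "'a ambient \<Rightarrow> ('a, 'o, 'm) rfun \<Rightarrow> 'a gobj \<Rightarrow> ('a, 'o) pobj \<Rightarrow> ('a, 'o) pobj \<Rightarrow> ('a, 'm) span \<Rightarrow> bool" where
  "is_span \<G> \<A> G X Y \<Phi> \<longleftrightarrow>
     is_omor \<G> G (Leg1 \<Phi>) \<and> is_omor \<G> G (Leg2 \<Phi>) \<and> OSrc (Leg1 \<Phi>) = OSrc (Leg2 \<Phi>) \<and>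
     OSrc (Leg1 \<Phi>) \<in> over_faithful \<G> G \<and> OTgt (Leg1 \<Phi>) = fst X \<and> OTgt (Leg2 \<Phi>) = fst Y \<and>
     SMor \<Phi> \<in> Hom (Cat \<A> (Src (OSrc (Leg1 \<Phi>))))
        (FO (Res \<A> (OMor (Leg1 \<Phi>))) (snd X)) (FO (Res \<A> (OMor (Leg2 \<Phi>))) (snd Y))"

definition span_step ::
  "'a ambient \<Rightarrow> ('a, 'o, 'm) rfun \<Rightarrow> 'a gobj \<Rightarrow> ('a, 'o) pobj \<Rightarrow> ('a, 'o) pobj \<Rightarrow>
   ('a, 'm) span \<Rightarrow> ('a, 'm) span \<Rightarrow> bool" where
  "span_step \<G> \<A> G X Y \<Phi> \<Phi>' \<longleftrightarrow> is_span \<G> \<A> G X Y \<Phi> \<and> is_span \<G> \<A> G X Y \<Phi>' \<and>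
     (\<exists>s \<sigma>1 \<sigma>2. s \<in> local_omors \<G> G \<and>
        OSrc s = OSrc (Leg1 \<Phi>) \<and> OTgt s = OSrc (Leg1 \<Phi>') \<and>
        is_ocell \<G> G (Leg1 \<Phi>) (ocomp \<G> (Leg1 \<Phi>') s) \<sigma>1 \<and>
        is_ocell \<G> G (Leg2 \<Phi>) (ocomp \<G> (Leg2 \<Phi>') s) \<sigma>2 \<and>
        (let C = Cat \<A> (Src (OSrc s)) in
         SMor \<Phi>' = trace \<G> \<A> (OMor s)
           (FO (Res \<A> (OMor (Leg1 \<Phi>'))) (snd X)) (FO (Res \<A> (OMor (Leg2 \<Phi>'))) (snd Y))
           (ResC \<A> \<sigma>2 (snd Y) \<cdot>\<^bsub>C\<^esub> SMor \<Phi> \<cdot>\<^bsub>C\<^esub> inv_arrow C (ResC \<A> \<sigma>1 (snd X)))))"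

definition span_class ::
  "'a ambient \<Rightarrow> ('a, 'o, 'm) rfun \<Rightarrow> 'a gobj \<Rightarrow> ('a, 'o) pobj \<Rightarrow> ('a, 'o) pobj \<Rightarrow>
   ('a, 'm) span \<Rightarrow> ('a, 'm) span set" where
  "span_class \<G> \<A> G X Y \<Phi> = {\<Psi>. equivclp (span_step \<G> \<A> G X Y) \<Phi> \<Psi>}"

definition plus_objs :: "'a ambient \<Rightarrow> ('a, 'o, 'm) rfun \<Rightarrow> 'a gobj \<Rightarrow> ('a, 'o) pobj set" where
  "plus_objs \<G> \<A> G = {(\<sigma>, x). \<sigma> \<in> over_faithful \<G> G \<and> x \<in> Ob (Cat \<A> (Src \<sigma>))}"

text \<open>
  The class of a composite is the union, over all representatives and all Mackey squares, of the
  classes of the composite spans; all of these classes coincide.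
\<close>

definition plus_cat ::
  "'a ambient \<Rightarrow> ('a, 'o, 'm) rfun \<Rightarrow> 'a gobj \<Rightarrow> (('a, 'o) pobj, ('a, 'o, 'm) parr) cat" where
  "plus_cat \<G> \<A> G = \<lparr>Ob = plus_objs \<G> \<A> G,
     Ar = {(X, Y, span_class \<G> \<A> G X Y \<Phi>) | X Y \<Phi>.
             X \<in> plus_objs \<G> \<A> G \<and> Y \<in> plus_objs \<G> \<A> G \<and> is_span \<G> \<A> G X Y \<Phi>},
     Dom = fst, Cod = fst \<circ> snd,
     Idn = (\<lambda>(\<sigma>, x). ((\<sigma>, x), (\<sigma>, x), span_class \<G> \<A> G (\<sigma>, x) (\<sigma>, x)
             \<lparr>Leg1 = oid \<G> \<sigma>, Leg2 = oid \<G> \<sigma>, SMor = Idn (Cat \<A> (Src \<sigma>)) x\<rparr>)),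
     Cmp = (\<lambda>(Y', Z, d) (X, Y, c). (X, Z, \<Union>{span_class \<G> \<A> G X Z
               \<lparr>Leg1 = ocomp \<G> (Leg1 \<Phi>) u, Leg2 = ocomp \<G> (Leg2 \<Theta>) v,
                SMor = (let C = Cat \<A> (Src (OSrc u)) in
                  FA (Res \<A> (OMor v)) (SMor \<Theta>) \<cdot>\<^bsub>C\<^esub> ResC \<A> \<gamma> (snd Y) \<cdot>\<^bsub>C\<^esub>
                  FA (Res \<A> (OMor u)) (SMor \<Phi>))\<rparr>
             | \<Phi> \<Theta> u v \<gamma>. \<Phi> \<in> c \<and> \<Theta> \<in> d \<and> OSrc u = OSrc v \<and>
                 OTgt u = OSrc (Leg2 \<Phi>) \<and> OTgt v = OSrc (Leg1 \<Theta>) \<and>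
                 is_ocell \<G> G (ocomp \<G> (Leg2 \<Phi>) u) (ocomp \<G> (Leg1 \<Theta>) v) \<gamma> \<and>
                 is_omor \<G> G u \<and> is_omor \<G> G v \<and>
                 mackey_square \<G> (OMor (Leg2 \<Phi>)) (OMor (Leg1 \<Theta>)) (OMor u) (OMor v) \<gamma>}))\<rparr>"

text \<open>The functor \<open>(t\<^sub>\<oplus>)\<^sub>G\<close> induced by a morphism \<open>t\<close> from \<open>\<A>\<close> to \<open>\<A>'\<close>.\<close>

definition plus_fun ::
  "'a ambient \<Rightarrow> ('a, 'p, 'n) rfun \<Rightarrow> ('a, 'o, 'm, 'p, 'n) rtrans \<Rightarrow> 'a gobj \<Rightarrow>
   (('a, 'o) pobj, ('a, 'o, 'm) parr, ('a, 'p) pobj, ('a, 'p, 'n) parr) fctr" where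
  "plus_fun \<G> \<A>' t G =
     (let O1 = (\<lambda>(\<sigma>, x). (\<sigma>, FO (TrF t (Src \<sigma>)) x)) in
      \<lparr>FO = O1,
       FA = (\<lambda>(X, Y, c). (O1 X, O1 Y, \<Union>{span_class \<G> \<A>' G (O1 X) (O1 Y)
           (let P = Src (OSrc (Leg1 \<Phi>)); C = Cat \<A>' P in
            \<lparr>Leg1 = Leg1 \<Phi>, Leg2 = Leg2 \<Phi>,
             SMor = inv_arrow C (TrN t (OMor (Leg2 \<Phi>)) (snd Y)) \<cdot>\<^bsub>C\<^esub> FA (TrF t P) (SMor \<Phi>) \<cdot>\<^bsub>C\<^esub>
                    TrN t (OMor (Leg1 \<Phi>)) (snd X)\<rparr>) | \<Phi>. \<Phi> \<in> c}))\<rparr>)"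


section \<open>The Mackey 2-functor \<open>\<A>\<^sup>\<oplus>\<close>\<close>

record ('a, 'o, 'm) fam =
  Lev :: "'a gmor \<Rightarrow> 'o"
  Coh :: "'a omor \<Rightarrow> 'm"

type_synonym ('a, 'o, 'm) famarr = "('a, 'o, 'm) fam \<times> ('a, 'o, 'm) fam \<times> ('a gmor \<Rightarrow> 'm)"

text \<open>
  The inclusions of a disjoint union are local equivalences, so the identification of
  \<open>x (H1 \<squnion> H2)\<close> with \<open>(x H1, x H2)\<close> is contained in \<open>Coh x\<close> being invertible.
\<close>

definition is_family :: "'a ambient \<Rightarrow> ('a, 'o, 'm) rfun \<Rightarrow> 'a gobj \<Rightarrow> ('a, 'o, 'm) fam \<Rightarrow> bool" where
  "is_family \<G> \<A> G x \<longleftrightarrow>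
     Lev x \<in> extensional (over \<G> G) \<and> Coh x \<in> extensional (local_omors \<G> G) \<and>
     (\<forall>\<sigma>\<in>over \<G> G. Lev x \<sigma> \<in> Ob (Cat \<A> (Src \<sigma>))) \<and>
     (\<forall>s\<in>local_omors \<G> G. Coh x s \<in> Iso (Cat \<A> (Src (OSrc s)))
        (Lev x (OSrc s)) (FO (Res \<A> (OMor s)) (Lev x (OTgt s)))) \<and>
     (\<forall>\<sigma>\<in>over \<G> G. Coh x (oid \<G> \<sigma>) = Idn (Cat \<A> (Src \<sigma>)) (Lev x \<sigma>)) \<and>
     (\<forall>s\<in>local_omors \<G> G. \<forall>t\<in>local_omors \<G> G. OTgt s = OSrc t \<longrightarrow>
        Coh x (ocomp \<G> t s) = FA (Res \<A> (OMor s)) (Coh x t) \<cdot>\<^bsub>Cat \<A> (Src (OSrc s))\<^esub> Coh x s) \<and>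
     (\<forall>s\<in>local_omors \<G> G. \<forall>t\<in>local_omors \<G> G. \<forall>\<alpha>. is_ocell \<G> G s t \<alpha> \<longrightarrow>
        ResC \<A> \<alpha> (Lev x (OTgt s)) \<cdot>\<^bsub>Cat \<A> (Src (OSrc s))\<^esub> Coh x s = Coh x t)"

definition is_family_arrow ::
  "'a ambient \<Rightarrow> ('a, 'o, 'm) rfun \<Rightarrow> 'a gobj \<Rightarrow> ('a, 'o, 'm) famarr \<Rightarrow> bool" where
  "is_family_arrow \<G> \<A> G = (\<lambda>(x, y, f).
     is_family \<G> \<A> G x \<and> is_family \<G> \<A> G y \<and> f \<in> extensional (over \<G> G) \<and>
     (\<forall>\<sigma>\<in>over \<G> G. f \<sigma> \<in> Hom (Cat \<A> (Src \<sigma>)) (Lev x \<sigma>) (Lev y \<sigma>)) \<and>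
     (\<forall>s\<in>local_omors \<G> G. Coh y s \<cdot>\<^bsub>Cat \<A> (Src (OSrc s))\<^esub> f (OSrc s) =
        FA (Res \<A> (OMor s)) (f (OTgt s)) \<cdot>\<^bsub>Cat \<A> (Src (OSrc s))\<^esub> Coh x s))"

definition sup_cat ::
  "'a ambient \<Rightarrow> ('a, 'o, 'm) rfun \<Rightarrow> 'a gobj \<Rightarrow> (('a, 'o, 'm) fam, ('a, 'o, 'm) famarr) acat" where
  "sup_cat \<G> \<A> G = \<lparr>Ob = {x. is_family \<G> \<A> G x}, Ar = {f. is_family_arrow \<G> \<A> G f},
     Dom = fst, Cod = fst \<circ> snd,
     Idn = (\<lambda>x. (x, x, \<lambda>\<sigma>\<in>over \<G> G. Idn (Cat \<A> (Src \<sigma>)) (Lev x \<sigma>))),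
     Cmp = (\<lambda>(y', z, g) (x, y, f). (x, z, \<lambda>\<sigma>\<in>over \<G> G. g \<sigma> \<cdot>\<^bsub>Cat \<A> (Src \<sigma>)\<^esub> f \<sigma>)),
     Add = (\<lambda>(x, y, f) (x', y', g). (x, y, \<lambda>\<sigma>\<in>over \<G> G. Add (Cat \<A> (Src \<sigma>)) (f \<sigma>) (g \<sigma>))),
     Zro = (\<lambda>x y. (x, y, \<lambda>\<sigma>\<in>over \<G> G. Zro (Cat \<A> (Src \<sigma>)) (Lev x \<sigma>) (Lev y \<sigma>)))\<rparr>"

definition sup_res_fam :: "'a ambient \<Rightarrow> 'a gmor \<Rightarrow> ('a, 'o, 'm) fam \<Rightarrow> ('a, 'o, 'm) fam" where
  "sup_res_fam \<G> j x =
     \<lparr>Lev = (\<lambda>\<sigma>\<in>over \<G> (Src j). Lev x (gcomp \<G> j \<sigma>)),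
      Coh = (\<lambda>s\<in>local_omors \<G> (Src j). Coh x (shriek_mor \<G> j s))\<rparr>"

text \<open>
  For a 2-cell \<open>\<alpha> : j \<Rightarrow> j'\<close>, the component of \<open>\<alpha>\<^sup>*\<close> at \<open>x\<close> and level \<open>\<sigma>\<close> is the coherence isomorphism
  of \<open>x\<close> at the identity functor viewed, by means of \<open>\<alpha> \<sigma>\<close>, as a 1-morphism from \<open>j\<^sub>! \<sigma>\<close> to \<open>j'\<^sub>! \<sigma>\<close>.
\<close>

definition sup_rfun ::
  "'a ambient \<Rightarrow> ('a, 'o, 'm) rfun \<Rightarrow> ('a, ('a, 'o, 'm) fam, ('a, 'o, 'm) famarr) rfun" where
  "sup_rfun \<G> \<A> = \<lparr>Cat = sup_cat \<G> \<A>,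
     Res = (\<lambda>j. \<lparr>FO = sup_res_fam \<G> j,
        FA = (\<lambda>(x, y, f). (sup_res_fam \<G> j x, sup_res_fam \<G> j y,
               \<lambda>\<sigma>\<in>over \<G> (Src j). f (gcomp \<G> j \<sigma>)))\<rparr>),
     ResC = (\<lambda>\<alpha> x. (sup_res_fam \<G> (CSrc \<alpha>) x, sup_res_fam \<G> (CTgt \<alpha>) x,
        \<lambda>\<sigma>\<in>over \<G> (Src (CSrc \<alpha>)). Coh x
          \<lparr>OSrc = gcomp \<G> (CSrc \<alpha>) \<sigma>, OTgt = gcomp \<G> (CTgt \<alpha>) \<sigma>,
           OMor = gid \<G> (Src \<sigma>), OCell = rwhisk \<G> \<alpha> \<sigma>\<rparr>))\<rparr>"

text \<open>
  Base change \<open>d\<^sub>* (v\<^sup>* w) \<rightarrow> s\<^sup>* (d'\<^sub>* w)\<close> for a commutative square \<open>d' v = s d\<close> with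
  \<open>d\<close>, \<open>d'\<close> local equivalences.
\<close>

definition fold_base_change ::
  "'a ambient \<Rightarrow> ('a, 'o, 'm) rfun \<Rightarrow> 'a gmor \<Rightarrow> 'a gmor \<Rightarrow> 'a gmor \<Rightarrow> 'a gmor \<Rightarrow> 'o \<Rightarrow> 'm" where
  "fold_base_change \<G> \<A> d v s d' w =
     (let I = folding_ind \<G> \<A> d; I' = folding_ind \<G> \<A> d' in
      Leps I (FO (Res \<A> s) (FO (Ind I') w)) \<cdot>\<^bsub>Cat \<A> (Src s)\<^esub>
      FA (Ind I) (FA (Res \<A> v) (Leta I' w)))"

definition sup_ind_fam ::
  "'a ambient \<Rightarrow> ('a, 'o, 'm) rfun \<Rightarrow> 'a gmor \<Rightarrow> ('a, 'o, 'm) fam \<Rightarrow> ('a, 'o, 'm) fam" where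
  "sup_ind_fam \<G> \<A> j x =
     \<lparr>Lev = (\<lambda>\<sigma>\<in>over \<G> (Tgt j). FO (Ind (folding_ind \<G> \<A> (nabla \<G> j \<sigma>))) (Lev x (pull_ff \<G> j \<sigma>))),
      Coh = (\<lambda>s\<in>local_omors \<G> (Tgt j).
        fold_base_change \<G> \<A> (nabla \<G> j (OSrc s)) (OMor (pull_ff_mor \<G> j s)) (OMor s)
          (nabla \<G> j (OTgt s)) (Lev x (pull_ff \<G> j (OTgt s)))
        \<cdot>\<^bsub>Cat \<A> (Src (OSrc s))\<^esub>
        FA (Ind (folding_ind \<G> \<A> (nabla \<G> j (OSrc s)))) (Coh x (pull_ff_mor \<G> j s)))\<rparr>"

definition sup_ind ::
  "'a ambient \<Rightarrow> ('a, 'o, 'm) rfun \<Rightarrow> 'a gmor \<Rightarrow>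
   (('a, 'o, 'm) fam, ('a, 'o, 'm) famarr, ('a, 'o, 'm) fam, ('a, 'o, 'm) famarr) fctr" where
  "sup_ind \<G> \<A> j = \<lparr>FO = sup_ind_fam \<G> \<A> j,
     FA = (\<lambda>(x, y, f). (sup_ind_fam \<G> \<A> j x, sup_ind_fam \<G> \<A> j y,
       \<lambda>\<sigma>\<in>over \<G> (Tgt j). FA (Ind (folding_ind \<G> \<A> (nabla \<G> j \<sigma>))) (f (pull_ff \<G> j \<sigma>))))\<rparr>"

text \<open>
  Units and counits of the two adjunctions between \<open>j\<^sub>*\<close> and \<open>j\<^sup>*\<close> on \<open>\<A>\<^sup>\<oplus>\<close>, for \<open>j\<close> faithful.
  The units \<open>Leta\<close> and counits \<open>Reps\<close> use the diagonal \<open>d : L \<rightarrow> j\<^sup>\<approx> (j\<^sub>! L)\<close>, \<open>b \<mapsto> (\<sigma> b, b, id)\<close>;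
  since \<open>nabla d = id\<close>, the functor \<open>d\<^sup>*\<close> takes \<open>w \<rightarrow> nabla\<^sup>* nabla\<^sub>* w\<close> to \<open>d\<^sup>* w \<rightarrow> nabla\<^sub>* w\<close>,
  the inclusion of the diagonal summand.  The counits \<open>Leps\<close> and units \<open>Reta\<close> use \<open>nabla\<close> itself,
  a local equivalence over the target of \<open>j\<close> by means of the canonical 2-cell of the isocomma.
\<close>

definition diag_mor :: "'a ambient \<Rightarrow> 'a gmor \<Rightarrow> 'a gmor \<Rightarrow> 'a omor" where
  "diag_mor \<G> j \<sigma> =
     (let L = Und (Src \<sigma>); P = pull_ff \<G> j (gcomp \<G> j \<sigma>);
          E = (\<lambda>b. Tup [FO (Fn \<sigma>) b, b, Idn (Und (Tgt j)) (FO (Fn j) (FO (Fn \<sigma>) b))]) in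
      \<lparr>OSrc = \<sigma>, OTgt = P,
       OMor = \<lparr>Src = Src \<sigma>, Tgt = Src P,
         Fn = frestr L \<lparr>FO = E, FA = (\<lambda>k. Tup [E (Dom L k), E (Cod L k), FA (Fn \<sigma>) k, k])\<rparr>,
         Tw = Tw \<sigma>\<rparr>,
       OCell = cid \<sigma>\<rparr>)"

definition nabla_mor :: "'a ambient \<Rightarrow> 'a gmor \<Rightarrow> 'a gmor \<Rightarrow> 'a omor" where
  "nabla_mor \<G> j \<sigma> =
     (let P = gcomp \<G> j (pull_ff \<G> j \<sigma>) in
      \<lparr>OSrc = P, OTgt = \<sigma>, OMor = nabla \<G> j \<sigma>,
       OCell = \<lparr>CSrc = P, CTgt = gcomp \<G> \<sigma> (nabla \<G> j \<sigma>), Cp = (\<lambda>z\<in>Ob (Und (Src P)). ent z 2)\<rparr>\<rparr>)"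

definition sup_mackey ::
  "'a ambient \<Rightarrow> ('a, 'o, 'm) rfun \<Rightarrow> 'a gmor \<Rightarrow> (('a, 'o, 'm) fam, ('a, 'o, 'm) famarr) adj2" where
  "sup_mackey \<G> \<A> j =
     (let fold = (\<lambda>\<sigma>. folding_ind \<G> \<A> (nabla \<G> j \<sigma>));
          down = sup_res_fam \<G> j; up = sup_ind_fam \<G> \<A> j;
          S = over \<G> (Src j); T = over \<G> (Tgt j) in
      \<lparr>Ind = sup_ind \<G> \<A> j,
       Leta = (\<lambda>x. (x, down (up x), \<lambda>\<sigma>\<in>S.
         FA (Res \<A> (OMor (diag_mor \<G> j \<sigma>)))
            (Leta (fold (gcomp \<G> j \<sigma>)) (Lev x (pull_ff \<G> j (gcomp \<G> j \<sigma>))))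
         \<cdot>\<^bsub>Cat \<A> (Src \<sigma>)\<^esub> Coh x (diag_mor \<G> j \<sigma>))),
       Leps = (\<lambda>x. (up (down x), x, \<lambda>\<sigma>\<in>T.
         Leps (fold \<sigma>) (Lev x \<sigma>) \<cdot>\<^bsub>Cat \<A> (Src \<sigma>)\<^esub> FA (Ind (fold \<sigma>)) (Coh x (nabla_mor \<G> j \<sigma>)))),
       Reta = (\<lambda>x. (x, up (down x), \<lambda>\<sigma>\<in>T.
         FA (Ind (fold \<sigma>)) (inv_arrow (Cat \<A> (Src (nabla \<G> j \<sigma>))) (Coh x (nabla_mor \<G> j \<sigma>)))
         \<cdot>\<^bsub>Cat \<A> (Src \<sigma>)\<^esub> Reta (fold \<sigma>) (Lev x \<sigma>))),
       Reps = (\<lambda>x. (down (up x), x, \<lambda>\<sigma>\<in>S.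
         inv_arrow (Cat \<A> (Src \<sigma>)) (Coh x (diag_mor \<G> j \<sigma>)) \<cdot>\<^bsub>Cat \<A> (Src \<sigma>)\<^esub>
         FA (Res \<A> (OMor (diag_mor \<G> j \<sigma>)))
            (Reps (fold (gcomp \<G> j \<sigma>)) (Lev x (pull_ff \<G> j (gcomp \<G> j \<sigma>))))))\<rparr>)"


section \<open>The mark transformation\<close>

definition eta_sup ::
  "'a ambient \<Rightarrow> ('a, 'o, 'm) rfun \<Rightarrow> ('a, 'o, 'm, ('a, 'o, 'm) fam, ('a, 'o, 'm) famarr) rtrans" where
  "eta_sup \<G> \<A> =
     (let E = (\<lambda>G x. \<lparr>Lev = (\<lambda>\<sigma>\<in>over \<G> G. FO (Res \<A> \<sigma>) x),
                      Coh = (\<lambda>s\<in>local_omors \<G> G. ResC \<A> (OCell s) x)\<rparr>) in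
      \<lparr>TrF = (\<lambda>G. \<lparr>FO = E G,
                   FA = (\<lambda>f. (E G (Dom (Cat \<A> G) f), E G (Cod (Cat \<A> G) f),
                              \<lambda>\<sigma>\<in>over \<G> G. FA (Res \<A> \<sigma>) f))\<rparr>),
       TrN = (\<lambda>u x. Idn (sup_cat \<G> \<A> (Src u)) (E (Src u) (FO (Res \<A> u) x)))\<rparr>)"

text \<open>
  For a 1-morphism \<open>p : P \<rightarrow> H\<close> over \<open>G\<close>, the isomorphism between \<open>(\<sigma>\<^sub>H)\<^sub>* p\<^sub>*\<close> and \<open>(\<sigma>\<^sub>P)\<^sub>*\<close>:
  from left to right as the mate of \<open>\<sigma>\<^sub>p\<close> for the adjunctions \<open>i\<^sup>* \<stileturn> i\<^sub>*\<close>, from right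
  to left as the mate of its inverse for the adjunctions \<open>i\<^sub>* \<stileturn> i\<^sup>*\<close>.
\<close>

definition ind_comp_to ::
  "('a, 'o, 'm) rfun \<Rightarrow> ('a gmor \<Rightarrow> ('o, 'm) adj2) \<Rightarrow> 'a omor \<Rightarrow> 'o \<Rightarrow> 'm" where
  "ind_comp_to \<M> \<I> p z =
     (let H = OTgt p; P = OSrc p; C = Cat \<M> (Src P); D = Cat \<M> (Tgt P);
          pz = FO (Ind (\<I> (OMor p))) z; w = FO (Ind (\<I> H)) pz in
      FA (Ind (\<I> P)) (Reps (\<I> (OMor p)) z \<cdot>\<^bsub>C\<^esub> FA (Res \<M> (OMor p)) (Reps (\<I> H) pz) \<cdot>\<^bsub>C\<^esub>
                      ResC \<M> (OCell p) w) \<cdot>\<^bsub>D\<^esub> Reta (\<I> P) w)"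

definition ind_comp_from ::
  "('a, 'o, 'm) rfun \<Rightarrow> ('a gmor \<Rightarrow> ('o, 'm) adj2) \<Rightarrow> 'a omor \<Rightarrow> 'o \<Rightarrow> 'm" where
  "ind_comp_from \<M> \<I> p z =
     (let H = OTgt p; P = OSrc p; C = Cat \<M> (Src P); D = Cat \<M> (Tgt P);
          pz = FO (Ind (\<I> (OMor p))) z; w = FO (Ind (\<I> H)) pz in
      Leps (\<I> P) w \<cdot>\<^bsub>D\<^esub>
      FA (Ind (\<I> P)) (ResC \<M> (cinv (OCell p)) w \<cdot>\<^bsub>C\<^esub> FA (Res \<M> (OMor p)) (Leta (\<I> H) pz) \<cdot>\<^bsub>C\<^esub>
                      Leta (\<I> (OMor p)) z))"

definition eps_span ::
  "('a, 'o, 'm) rfun \<Rightarrow> ('a gmor \<Rightarrow> ('o, 'm) adj2) \<Rightarrow> ('a, 'o) pobj \<Rightarrow> ('a, 'o) pobj \<Rightarrow>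
   ('a, 'm) span \<Rightarrow> 'm" where
  "eps_span \<M> \<I> X Y \<Phi> =
     (let H = fst X; x = snd X; K = fst Y; y = snd Y; p1 = Leg1 \<Phi>; p2 = Leg2 \<Phi>;
          P = OSrc p1; D = Cat \<M> (Tgt P) in
      FA (Ind (\<I> K)) (Leps (\<I> (OMor p2)) y) \<cdot>\<^bsub>D\<^esub>
      ind_comp_from \<M> \<I> p2 (FO (Res \<M> (OMor p2)) y) \<cdot>\<^bsub>D\<^esub>
      FA (Ind (\<I> P)) (SMor \<Phi>) \<cdot>\<^bsub>D\<^esub>
      ind_comp_to \<M> \<I> p1 (FO (Res \<M> (OMor p1)) x) \<cdot>\<^bsub>D\<^esub>
      FA (Ind (\<I> H)) (Reta (\<I> (OMor p1)) x))"

text \<open>The functor \<open>\<epsilon>\<close> from \<open>\<M>\<^sub>\<oplus>(G)\<close> to \<open>\<M>(G)\<close>, the same formula at every \<open>G\<close>.\<close>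

definition eps_plus ::
  "('a, 'o, 'm) rfun \<Rightarrow> ('a gmor \<Rightarrow> ('o, 'm) adj2) \<Rightarrow>
   (('a, 'o) pobj, ('a, 'o, 'm) parr, 'o, 'm) fctr" where
  "eps_plus \<M> \<I> = \<lparr>FO = (\<lambda>(\<sigma>, x). FO (Ind (\<I> \<sigma>)) x),
     FA = (\<lambda>(X, Y, c). eps_span \<M> \<I> X Y (SOME \<Phi>. \<Phi> \<in> c))\<rparr>"

definition mark ::
  "'a ambient \<Rightarrow> ('a, 'o, 'm) rfun \<Rightarrow> 'a gobj \<Rightarrow>
   (('a, 'o) pobj, ('a, 'o, 'm) parr, ('a, 'o, 'm) fam, ('a, 'o, 'm) famarr) fctr" where
  "mark \<G> \<A> G = fcomp (eps_plus (sup_rfun \<G> \<A>) (sup_mackey \<G> \<A>))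
     (plus_fun \<G> (sup_rfun \<G> \<A>) (eta_sup \<G> \<A>) G)"

end

theory Submission
  imports Defs
begin

text \<open>
  On objects, \<open>\<mu>\<close> is \<open>\<eta>\<close> at \<open>x\<close> followed by the induction of \<open>\<A>\<^sup>\<oplus>\<close> along \<open>\<sigma>\<^sub>H\<close>, so the formula results from
  unfolding the two constructions at level \<open>K\<close>.  As the levels of a family are meaningful only at
  1-morphisms of \<open>\<G>\<close>, what has to be proved is that \<open>p\<^sub>1\<close> is one, in each of the three cases of \<open>\<G>\<close>;
  in the second and the third, this uses that \<open>pr\<^sub>1\<close> is faithful because \<open>\<sigma>\<^sub>K\<close> is.
\<close>

section \<open>Categories and functors\<close>

lemma Hom_iff: "f \<in> Hom C x y \<longleftrightarrow> f \<in> Ar C \<and> Dom C f = x \<and> Cod C f = y"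
  by (simp add: Hom_def)

lemma in_HomI: "f \<in> Ar C \<Longrightarrow> f \<in> Hom C (Dom C f) (Cod C f)"
  by (simp add: Hom_def)

lemma category_Dom: "category C \<Longrightarrow> f \<in> Ar C \<Longrightarrow> Dom C f \<in> Ob C"
  and category_Cod: "category C \<Longrightarrow> f \<in> Ar C \<Longrightarrow> Cod C f \<in> Ob C"
  by (auto simp: category_def)

lemma category_Hom_Ob: "category C \<Longrightarrow> f \<in> Hom C x y \<Longrightarrow> x \<in> Ob C \<and> y \<in> Ob C"
  by (auto simp: category_def Hom_def)

lemma category_Idn: "category C \<Longrightarrow> x \<in> Ob C \<Longrightarrow> Idn C x \<in> Hom C x x"
  by (simp add: category_def)

lemma category_Cmp:
  "category C \<Longrightarrow> f \<in> Hom C x y \<Longrightarrow> g \<in> Hom C y z \<Longrightarrow> g \<cdot>\<^bsub>C\<^esub> f \<in> Hom C x z"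
  unfolding category_def by blast

lemma category_unit_right: "category C \<Longrightarrow> f \<in> Hom C x y \<Longrightarrow> f \<cdot>\<^bsub>C\<^esub> Idn C x = f"
  and category_unit_left: "category C \<Longrightarrow> f \<in> Hom C x y \<Longrightarrow> Idn C y \<cdot>\<^bsub>C\<^esub> f = f"
  unfolding category_def by blast+

lemma category_assoc:
  "category C \<Longrightarrow> f \<in> Hom C w x \<Longrightarrow> g \<in> Hom C x y \<Longrightarrow> h \<in> Hom C y z \<Longrightarrow>
    h \<cdot>\<^bsub>C\<^esub> (g \<cdot>\<^bsub>C\<^esub> f) = (h \<cdot>\<^bsub>C\<^esub> g) \<cdot>\<^bsub>C\<^esub> f"
  unfolding category_def by blast

text \<open>Two commutative squares are pasted along the common edge \<open>g2\<close>, by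
  reassociating three times. This serves both for composites in an isocomma and for composites of
  comparison isomorphisms over a group.\<close>

lemma square_paste:
  assumes G: "category G"
    and "g1 \<in> Hom G a1 b1" "g2 \<in> Hom G a2 b2" "g3 \<in> Hom G a3 b3"
    and "h \<in> Hom G a1 a2" "h' \<in> Hom G a2 a3" "k \<in> Hom G b1 b2" "k' \<in> Hom G b2 b3"
    and "g2 \<cdot>\<^bsub>G\<^esub> h = k \<cdot>\<^bsub>G\<^esub> g1" "g3 \<cdot>\<^bsub>G\<^esub> h' = k' \<cdot>\<^bsub>G\<^esub> g2"
  shows "g3 \<cdot>\<^bsub>G\<^esub> (h' \<cdot>\<^bsub>G\<^esub> h) = (k' \<cdot>\<^bsub>G\<^esub> k) \<cdot>\<^bsub>G\<^esub> g1"
proof -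
  have "g3 \<cdot>\<^bsub>G\<^esub> (h' \<cdot>\<^bsub>G\<^esub> h) = (k' \<cdot>\<^bsub>G\<^esub> g2) \<cdot>\<^bsub>G\<^esub> h"
    using category_assoc[OF G assms(5,6,4)] assms(10) by simp
  also have "\<dots> = k' \<cdot>\<^bsub>G\<^esub> (k \<cdot>\<^bsub>G\<^esub> g1)"
    using category_assoc[OF G assms(5,3,8)] assms(9) by simp
  also have "\<dots> = (k' \<cdot>\<^bsub>G\<^esub> k) \<cdot>\<^bsub>G\<^esub> g1"
    by (rule category_assoc[OF G assms(2,7,8)])
  finally show ?thesis .
qed

lemma categoryI:
  assumes "\<And>f. f \<in> Ar C \<Longrightarrow> Dom C f \<in> Ob C \<and> Cod C f \<in> Ob C"
    and "\<And>x. x \<in> Ob C \<Longrightarrow> Idn C x \<in> Hom C x x"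
    and "\<And>x y z f g. f \<in> Hom C x y \<Longrightarrow> g \<in> Hom C y z \<Longrightarrow> g \<cdot>\<^bsub>C\<^esub> f \<in> Hom C x z"
    and "\<And>x y f. f \<in> Hom C x y \<Longrightarrow> f \<cdot>\<^bsub>C\<^esub> Idn C x = f \<and> Idn C y \<cdot>\<^bsub>C\<^esub> f = f"
    and "\<And>w x y z f g h. f \<in> Hom C w x \<Longrightarrow> g \<in> Hom C x y \<Longrightarrow> h \<in> Hom C y z \<Longrightarrow>
      h \<cdot>\<^bsub>C\<^esub> (g \<cdot>\<^bsub>C\<^esub> f) = (h \<cdot>\<^bsub>C\<^esub> g) \<cdot>\<^bsub>C\<^esub> f"
  shows "category C"
  unfolding category_def using assms by blast

section \<open>Functors: composition, restriction to the domain, faithfulness\<close>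

lemma functor_Ob: "is_functor C D F \<Longrightarrow> x \<in> Ob C \<Longrightarrow> FO F x \<in> Ob D"
  and functor_Hom: "is_functor C D F \<Longrightarrow> f \<in> Hom C x y \<Longrightarrow> FA F f \<in> Hom D (FO F x) (FO F y)"
  and functor_Idn: "is_functor C D F \<Longrightarrow> x \<in> Ob C \<Longrightarrow> FA F (Idn C x) = Idn D (FO F x)"
  and functor_Cmp: "is_functor C D F \<Longrightarrow> f \<in> Hom C x y \<Longrightarrow> g \<in> Hom C y z \<Longrightarrow>
    FA F (g \<cdot>\<^bsub>C\<^esub> f) = FA F g \<cdot>\<^bsub>D\<^esub> FA F f"
  unfolding is_functor_def by blast+

lemma frestr_simps [simp]:
  "x \<in> Ob C \<Longrightarrow> FO (frestr C F) x = FO F x"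
  "f \<in> Ar C \<Longrightarrow> FA (frestr C F) f = FA F f"
  by (simp_all add: frestr_def)

lemma fcomp_simps [simp]: "FO (fcomp F' F) x = FO F' (FO F x)" "FA (fcomp F' F) f = FA F' (FA F f)"
  by (simp_all add: fcomp_def)

lemma fid_simps [simp]: "FO fid x = x" "FA fid f = f"
  by (simp_all add: fid_def)

lemma is_functor_fcomp:
  assumes "is_functor C D F" "is_functor D E F'"
  shows "is_functor C E (fcomp F' F)"
  unfolding is_functor_def
proof (intro conjI allI ballI impI)
  fix x y z f g
  assume "f \<in> Hom C x y" "g \<in> Hom C y z"
  then show "FA (fcomp F' F) (g \<cdot>\<^bsub>C\<^esub> f) = FA (fcomp F' F) g \<cdot>\<^bsub>E\<^esub> FA (fcomp F' F) f"
    by (simp add: functor_Cmp[OF assms(1)]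
        functor_Cmp[OF assms(2) functor_Hom[OF assms(1)] functor_Hom[OF assms(1)]])
qed (use assms in \<open>auto simp: functor_Ob functor_Hom functor_Idn\<close>)

text \<open>Because \<open>C\<close> is a category, endpoints, identities and composites stay in
  \<open>Ob C\<close> and \<open>Ar C\<close>, where \<open>frestr C F\<close> agrees with
  \<open>F\<close>; this carries the functor laws over.\<close>

lemma is_functor_frestr:
  assumes "category C" "is_functor C D F"
  shows "is_functor C D (frestr C F)"
  unfolding is_functor_def
proof (intro conjI allI ballI impI)
  fix x y z f g
  assume f: "f \<in> Hom C x y" and g: "g \<in> Hom C y z"
  with category_Cmp[OF assms(1) f g]
  have "f \<in> Ar C" "g \<in> Ar C" "g \<cdot>\<^bsub>C\<^esub> f \<in> Ar C" by (auto simp: Hom_iff)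
  then show "FA (frestr C F) (g \<cdot>\<^bsub>C\<^esub> f) = FA (frestr C F) g \<cdot>\<^bsub>D\<^esub> FA (frestr C F) f"
    using functor_Cmp[OF assms(2) f g] by simp
next
  fix x y f
  assume f: "f \<in> Hom C x y"
  then show "FA (frestr C F) f \<in> Hom D (FO (frestr C F) x) (FO (frestr C F) y)"
    using functor_Hom[OF assms(2) f] category_Hom_Ob[OF assms(1) f] by (simp add: Hom_iff)
next
  fix x
  assume x: "x \<in> Ob C"
  then show "FA (frestr C F) (Idn C x) = Idn D (FO (frestr C F) x)"
    using functor_Idn[OF assms(2) x] category_Idn[OF assms(1) x] by (simp add: Hom_iff)
qed (use functor_Ob[OF assms(2)] in simp)

lemma ext_functor_frestr:
  "category C \<Longrightarrow> is_functor C D F \<Longrightarrow> ext_functor C D (frestr C F)"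
  by (simp add: ext_functor_def is_functor_frestr) (simp add: frestr_def)

lemma faithful_frestr: "faithful C (frestr C F) = faithful C F"
proof -
  have "inj_on (FA (frestr C F)) (Hom C x y) = inj_on (FA F) (Hom C x y)" for x y
    by (rule inj_on_cong) (simp add: Hom_iff)
  then show ?thesis by (simp add: faithful_def)
qed

lemma faithful_fcomp:
  assumes "is_functor C D F" "faithful C F" "faithful D F'"
  shows "faithful C (fcomp F' F)"
  unfolding faithful_def
proof (intro ballI inj_onI)
  fix x y f g
  assume xy: "x \<in> Ob C" "y \<in> Ob C" and fg: "f \<in> Hom C x y" "g \<in> Hom C x y"
    and eq: "FA (fcomp F' F) f = FA (fcomp F' F) g"
  have "FA F f = FA F g"
    using assms(3) eq functor_Ob[OF assms(1)] functor_Hom[OF assms(1)] xy fg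
    unfolding faithful_def inj_on_def fcomp_simps by blast
  then show "f = g"
    using assms(2) xy fg unfolding faithful_def inj_on_def by blast
qed


section \<open>Finite groupoids\<close>

lemma finite_groupoid_category: "finite_groupoid C \<Longrightarrow> category C"
  by (simp add: finite_groupoid_def)

lemma finite_groupoid_inverse:
  assumes "finite_groupoid C" "f \<in> Hom C x y"
  obtains g where "g \<in> Hom C y x" "g \<cdot>\<^bsub>C\<^esub> f = Idn C x" "f \<cdot>\<^bsub>C\<^esub> g = Idn C y"
  using assms by (auto simp: finite_groupoid_def iso_arrow_def inverse_arrows_def Hom_iff)

text \<open>Compose with an inverse of \<open>f\<close> on the right. In an isocomma,
  \<open>f\<close> will be the structure arrow of an object, and cancelling it recovers the image of
  the second component of an arrow.\<close>

lemma finite_groupoid_cancel_right: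
  assumes C: "finite_groupoid C" and f: "f \<in> Hom C x y"
    and g: "g \<in> Hom C y z" "g' \<in> Hom C y z" and eq: "g \<cdot>\<^bsub>C\<^esub> f = g' \<cdot>\<^bsub>C\<^esub> f"
  shows "g = g'"
proof -
  note cat = finite_groupoid_category[OF C]
  obtain k where k: "k \<in> Hom C y x" "f \<cdot>\<^bsub>C\<^esub> k = Idn C y"
    using finite_groupoid_inverse[OF C f] by metis
  show ?thesis
    using category_assoc[OF cat k(1) f g(1)] category_assoc[OF cat k(1) f g(2)] eq k(2)
      category_unit_right[OF cat g(1)] category_unit_right[OF cat g(2)] by simp
qed

section \<open>The one-object groupoid of a group\<close>

lemma deloop_sel:
  "Ob (deloop \<Gamma>) = {Atom \<one>\<^bsub>\<Gamma>\<^esub>}" "Ar (deloop \<Gamma>) = Atom ` carrier \<Gamma>"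
  "f \<in> Hom (deloop \<Gamma>) a b \<longleftrightarrow> f \<in> Atom ` carrier \<Gamma> \<and> a = Atom \<one>\<^bsub>\<Gamma>\<^esub> \<and> b = Atom \<one>\<^bsub>\<Gamma>\<^esub>"
  "Idn (deloop \<Gamma>) (Atom \<one>\<^bsub>\<Gamma>\<^esub>) = Atom \<one>\<^bsub>\<Gamma>\<^esub>"
  by (auto simp: deloop_def Let_def Hom_iff)

lemma deloop_Cmp:
  "g \<in> carrier \<Gamma> \<Longrightarrow> f \<in> carrier \<Gamma> \<Longrightarrow> Atom g \<cdot>\<^bsub>deloop \<Gamma>\<^esub> Atom f = Atom (g \<otimes>\<^bsub>\<Gamma>\<^esub> f)"
  by (simp add: deloop_def Let_def)

lemma category_deloop:
  assumes "group \<Gamma>"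
  shows "category (deloop \<Gamma>)"
proof -
  interpret group \<Gamma> by fact
  show ?thesis
  proof (rule categoryI)
    fix f assume "f \<in> Ar (deloop \<Gamma>)"
    then show "Dom (deloop \<Gamma>) f \<in> Ob (deloop \<Gamma>) \<and> Cod (deloop \<Gamma>) f \<in> Ob (deloop \<Gamma>)"
      by (simp add: deloop_def Let_def)
  qed (auto simp: deloop_sel deloop_Cmp m_assoc)
qed

section \<open>Full subgroupoids\<close>

lemma full_sub_sel:
  "Ob (full_sub C S) = Ob C \<inter> S"
  "f \<in> Ar (full_sub C S) \<longleftrightarrow> f \<in> Ar C \<and> Dom C f \<in> S \<and> Cod C f \<in> S"
  "f \<in> Hom (full_sub C S) x y \<longleftrightarrow> f \<in> Hom C x y \<and> x \<in> S \<and> y \<in> S"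
  "x \<in> Ob C \<Longrightarrow> x \<in> S \<Longrightarrow> Idn (full_sub C S) x = Idn C x"
  by (auto simp: full_sub_def Let_def Hom_iff)

lemma full_sub_Cmp:
  "f \<in> Hom (full_sub C S) x y \<Longrightarrow> g \<in> Hom (full_sub C S) y z \<Longrightarrow>
    g \<cdot>\<^bsub>full_sub C S\<^esub> f = g \<cdot>\<^bsub>C\<^esub> f"
  by (auto simp: full_sub_def Let_def Hom_iff)

lemma category_full_sub:
  assumes "category C"
  shows "category (full_sub C S)"
proof (rule categoryI)
  fix f assume "f \<in> Ar (full_sub C S)"
  then show "Dom (full_sub C S) f \<in> Ob (full_sub C S) \<and> Cod (full_sub C S) f \<in> Ob (full_sub C S)"
    using category_Dom[OF assms] category_Cod[OF assms] by (auto simp: full_sub_def Let_def)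
next
  fix x assume "x \<in> Ob (full_sub C S)"
  then show "Idn (full_sub C S) x \<in> Hom (full_sub C S) x x"
    using category_Idn[OF assms] by (simp add: full_sub_sel)
next
  fix x y z f g assume "f \<in> Hom (full_sub C S) x y" "g \<in> Hom (full_sub C S) y z"
  then show "g \<cdot>\<^bsub>full_sub C S\<^esub> f \<in> Hom (full_sub C S) x z"
    using full_sub_Cmp category_Cmp[OF assms] by (metis full_sub_sel(3))
next
  fix x y f assume f: "f \<in> Hom (full_sub C S) x y"
  then have f': "f \<in> Hom C x y" "x \<in> S" "y \<in> S" by (simp_all add: full_sub_sel)
  with category_Hom_Ob[OF assms f'(1)] have xy: "x \<in> Ob C" "y \<in> Ob C" by simp_all
  have "Idn (full_sub C S) x \<in> Hom (full_sub C S) x x" "Idn (full_sub C S) y \<in> Hom (full_sub C S) y y"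
    using category_Idn[OF assms] xy f' by (simp_all add: full_sub_sel)
  then show "f \<cdot>\<^bsub>full_sub C S\<^esub> Idn (full_sub C S) x = f \<and> Idn (full_sub C S) y \<cdot>\<^bsub>full_sub C S\<^esub> f = f"
    using full_sub_Cmp f category_unit_left[OF assms f'(1)] category_unit_right[OF assms f'(1)]
      full_sub_sel(4) xy f'(2,3) by metis
next
  fix w x y z f g h
  assume f: "f \<in> Hom (full_sub C S) w x" and g: "g \<in> Hom (full_sub C S) x y"
    and h: "h \<in> Hom (full_sub C S) y z"
  have "g \<cdot>\<^bsub>C\<^esub> f \<in> Hom (full_sub C S) w y" "h \<cdot>\<^bsub>C\<^esub> g \<in> Hom (full_sub C S) x z"
    using f g h category_Cmp[OF assms] by (metis full_sub_sel(3))+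
  then show "h \<cdot>\<^bsub>full_sub C S\<^esub> (g \<cdot>\<^bsub>full_sub C S\<^esub> f) = h \<cdot>\<^bsub>full_sub C S\<^esub> g \<cdot>\<^bsub>full_sub C S\<^esub> f"
    using full_sub_Cmp f g h category_assoc[OF assms] by (metis full_sub_sel(3))
qed

text \<open>An inverse in \<open>C\<close> of an arrow between objects of \<open>S\<close> runs
  between the same two objects, so fullness puts it into \<open>full_sub C S\<close>.\<close>

lemma finite_groupoid_full_sub:
  assumes C: "finite_groupoid C"
  shows "finite_groupoid (full_sub C S)"
proof -
  note cat = finite_groupoid_category[OF C]
  have "iso_arrow (full_sub C S) f" if "f \<in> Ar (full_sub C S)" for f
  proof -
    let ?x = "Dom (full_sub C S) f" and ?y = "Cod (full_sub C S) f"
    have f: "f \<in> Hom (full_sub C S) ?x ?y" using that by (rule in_HomI)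
    then have f': "f \<in> Hom C ?x ?y" "?x \<in> S" "?y \<in> S" by (simp_all add: full_sub_sel)
    obtain g where g: "g \<in> Hom C ?y ?x" "g \<cdot>\<^bsub>C\<^esub> f = Idn C ?x" "f \<cdot>\<^bsub>C\<^esub> g = Idn C ?y"
      using finite_groupoid_inverse[OF C f'(1)] .
    then have "g \<in> Hom (full_sub C S) ?y ?x" using f' by (simp add: full_sub_sel)
    moreover have "?x \<in> Ob C" "?y \<in> Ob C" using category_Hom_Ob[OF cat f'(1)] by simp_all
    ultimately have "inverse_arrows (full_sub C S) f g"
      using that f f' g by (simp add: inverse_arrows_def full_sub_Cmp[of _ _ _ "?x"]
          full_sub_Cmp[of _ _ _ "?y"] full_sub_sel)
    then show ?thesis by (auto simp: iso_arrow_def)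
  qed
  moreover have "finite (Ob (full_sub C S))" "finite (Ar (full_sub C S))"
    using C by (auto simp: finite_groupoid_def full_sub_def Let_def)
  moreover have "Dom (full_sub C S) \<in> extensional (Ar (full_sub C S))"
    "Cod (full_sub C S) \<in> extensional (Ar (full_sub C S))"
    "Idn (full_sub C S) \<in> extensional (Ob (full_sub C S))"
    by (auto simp: full_sub_def Let_def)
  moreover have "g \<cdot>\<^bsub>full_sub C S\<^esub> f = undefined"
    if "\<not> (f \<in> Ar (full_sub C S) \<and> g \<in> Ar (full_sub C S) \<and> Dom (full_sub C S) g = Cod (full_sub C S) f)"
    for g f
    \<comment> \<open>\<open>full_sub\<close> only tests that both arrows belong to it. For two such
      arrows that do not compose, the value \<open>undefined\<close> comes from the extensionality
      of the composition of \<open>C\<close>.\<close>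
    using that C by (auto simp: full_sub_def Let_def finite_groupoid_def)
  ultimately show ?thesis
    using category_full_sub[OF cat] unfolding finite_groupoid_def by blast
qed

lemma is_functor_fid_full_sub: "category C \<Longrightarrow> is_functor (full_sub C S) C fid"
  unfolding is_functor_def by (auto simp: full_sub_sel full_sub_Cmp)

lemma faithful_fid: "faithful C fid"
  by (simp add: faithful_def inj_on_def)


section \<open>Isocommas\<close>

lemma isocomma_Ob:
  "z \<in> Ob (isocomma_gpd i u) \<longleftrightarrow> (\<exists>a b g. z = Tup [a, b, g] \<and> a \<in> Ob (Und (Src i)) \<and>
     b \<in> Ob (Und (Src u)) \<and> g \<in> Hom (Und (Tgt i)) (FO (Fn i) a) (FO (Fn u) b))"
  by (simp add: isocomma_gpd_def Let_def)

lemma isocomma_Ar: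
  "m \<in> Ar (isocomma_gpd i u) \<longleftrightarrow> (\<exists>z z' h k. m = Tup [z, z', h, k] \<and>
     z \<in> Ob (isocomma_gpd i u) \<and> z' \<in> Ob (isocomma_gpd i u) \<and>
     h \<in> Hom (Und (Src i)) (ent z 0) (ent z' 0) \<and> k \<in> Hom (Und (Src u)) (ent z 1) (ent z' 1) \<and>
     ent z' 2 \<cdot>\<^bsub>Und (Tgt i)\<^esub> FA (Fn i) h = FA (Fn u) k \<cdot>\<^bsub>Und (Tgt i)\<^esub> ent z 2)"
  \<comment> \<open>Unfolding also turns each \<open>Ob (isocomma_gpd i u)\<close> on the right into
    the set \<open>U\<close> of the definition, after which the two sides coincide
    literally.\<close>
  unfolding isocomma_gpd_def Let_def cat.simps mem_Collect_eq by (rule refl)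

lemma isocomma_Dom: "m \<in> Ar (isocomma_gpd i u) \<Longrightarrow> Dom (isocomma_gpd i u) m = ent m 0"
  and isocomma_Cod: "m \<in> Ar (isocomma_gpd i u) \<Longrightarrow> Cod (isocomma_gpd i u) m = ent m 1"
  unfolding isocomma_gpd_def Let_def cat.simps by (simp_all only: restrict_apply')

text \<open>One pair \<open>(h, k)\<close> may be an arrow between several pairs of objects, so an
  arrow stores its endpoints as entries 0 and 1. Membership in a hom-set fixes these entries and
  leaves only \<open>h\<close> and \<open>k\<close> to be described.\<close>

lemma isocomma_Hom:
  "m \<in> Hom (isocomma_gpd i u) z z' \<longleftrightarrow>
     z \<in> Ob (isocomma_gpd i u) \<and> z' \<in> Ob (isocomma_gpd i u) \<and>
     (\<exists>h k. m = Tup [z, z', h, k] \<and>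
       h \<in> Hom (Und (Src i)) (ent z 0) (ent z' 0) \<and> k \<in> Hom (Und (Src u)) (ent z 1) (ent z' 1) \<and>
       ent z' 2 \<cdot>\<^bsub>Und (Tgt i)\<^esub> FA (Fn i) h = FA (Fn u) k \<cdot>\<^bsub>Und (Tgt i)\<^esub> ent z 2)"
proof -
  have "m \<in> Hom (isocomma_gpd i u) z z' \<longleftrightarrow>
      m \<in> Ar (isocomma_gpd i u) \<and> ent m 0 = z \<and> ent m 1 = z'"
    unfolding Hom_iff using isocomma_Dom isocomma_Cod by metis
  then show ?thesis
    by (auto simp: isocomma_Ar)
qed

lemma isocomma_Idn:
  "z \<in> Ob (isocomma_gpd i u) \<Longrightarrow>
    Idn (isocomma_gpd i u) z = Tup [z, z, Idn (Und (Src i)) (ent z 0), Idn (Und (Src u)) (ent z 1)]"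
  by (simp add: isocomma_gpd_def Let_def)

lemma isocomma_Cmp_eq:
  "n \<cdot>\<^bsub>isocomma_gpd i u\<^esub> m =
    (if m \<in> Ar (isocomma_gpd i u) \<and> n \<in> Ar (isocomma_gpd i u) \<and> ent n 0 = ent m 1
     then Tup [ent m 0, ent n 1, ent n 2 \<cdot>\<^bsub>Und (Src i)\<^esub> ent m 2, ent n 3 \<cdot>\<^bsub>Und (Src u)\<^esub> ent m 3]
     else undefined)"
  unfolding isocomma_gpd_def Let_def cat.simps by (rule refl)

lemma isocomma_Cmp:
  assumes "m \<in> Hom (isocomma_gpd i u) x y" "n \<in> Hom (isocomma_gpd i u) y z"
  shows "n \<cdot>\<^bsub>isocomma_gpd i u\<^esub> m =
    Tup [x, z, ent n 2 \<cdot>\<^bsub>Und (Src i)\<^esub> ent m 2, ent n 3 \<cdot>\<^bsub>Und (Src u)\<^esub> ent m 3]"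
proof -
  have "ent m 0 = x" "ent m 1 = y" "ent n 0 = y" "ent n 1 = z"
    using assms by (auto simp: isocomma_Hom)
  moreover have "m \<in> Ar (isocomma_gpd i u)" "n \<in> Ar (isocomma_gpd i u)"
    using assms by (simp_all add: Hom_iff)
  ultimately show ?thesis
    by (simp add: isocomma_Cmp_eq)
qed

section \<open>The isocomma of two functors of finite groupoids, and its first projection\<close>

context
  fixes i u :: "'a gmor"
  assumes H: "finite_groupoid (Und (Src i))" and K: "finite_groupoid (Und (Src u))"
    and G: "finite_groupoid (Und (Tgt i))" and tgt: "Tgt u = Tgt i"
    and i: "is_functor (Und (Src i)) (Und (Tgt i)) (Fn i)"
    and u: "is_functor (Und (Src u)) (Und (Tgt u)) (Fn u)"
begin

private lemma cats:
  "category (Und (Src i))" "category (Und (Src u))" "category (Und (Tgt i))"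
  using H K G by (simp_all add: finite_groupoid_category)

private lemma fun_u: "is_functor (Und (Src u)) (Und (Tgt i)) (Fn u)"
  using u tgt by simp

text \<open>Functors preserve identities, so the defining square of the identity pair reduces to the
  unit laws for the structure arrow \<open>g\<close>.\<close>

lemma isocomma_Idn_in:
  assumes z: "z \<in> Ob (isocomma_gpd i u)"
  shows "Idn (isocomma_gpd i u) z \<in> Hom (isocomma_gpd i u) z z"
proof -
  obtain a b g where z': "z = Tup [a, b, g]" "a \<in> Ob (Und (Src i))" "b \<in> Ob (Und (Src u))"
    "g \<in> Hom (Und (Tgt i)) (FO (Fn i) a) (FO (Fn u) b)"
    using z by (auto simp: isocomma_Ob)
  then show ?thesis
    using z category_Idn[OF cats(1)] category_Idn[OF cats(2)] functor_Idn[OF i] functor_Idn[OF fun_u]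
      category_unit_left[OF cats(3) z'(4)] category_unit_right[OF cats(3) z'(4)]
    by (simp add: isocomma_Hom isocomma_Idn)
qed

text \<open>The defining squares of \<open>m\<close> and \<open>n\<close> share the structure arrow
  of \<open>y\<close> and are pasted along it; functoriality of \<open>i\<close> and
  \<open>u\<close> then gives the square of the composite pair.\<close>

lemma isocomma_Cmp_in:
  assumes m: "m \<in> Hom (isocomma_gpd i u) x y" and n: "n \<in> Hom (isocomma_gpd i u) y z"
  shows "n \<cdot>\<^bsub>isocomma_gpd i u\<^esub> m \<in> Hom (isocomma_gpd i u) x z"
proof -
  obtain h k where m': "m = Tup [x, y, h, k]" "h \<in> Hom (Und (Src i)) (ent x 0) (ent y 0)"
    "k \<in> Hom (Und (Src u)) (ent x 1) (ent y 1)"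
    "ent y 2 \<cdot>\<^bsub>Und (Tgt i)\<^esub> FA (Fn i) h = FA (Fn u) k \<cdot>\<^bsub>Und (Tgt i)\<^esub> ent x 2"
    "x \<in> Ob (isocomma_gpd i u)" "y \<in> Ob (isocomma_gpd i u)"
    using m by (auto simp: isocomma_Hom)
  obtain h' k' where n': "n = Tup [y, z, h', k']" "h' \<in> Hom (Und (Src i)) (ent y 0) (ent z 0)"
    "k' \<in> Hom (Und (Src u)) (ent y 1) (ent z 1)"
    "ent z 2 \<cdot>\<^bsub>Und (Tgt i)\<^esub> FA (Fn i) h' = FA (Fn u) k' \<cdot>\<^bsub>Und (Tgt i)\<^esub> ent y 2"
    "z \<in> Ob (isocomma_gpd i u)"
    using n by (auto simp: isocomma_Hom)
  have g: "ent w 2 \<in> Hom (Und (Tgt i)) (FO (Fn i) (ent w 0)) (FO (Fn u) (ent w 1))"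
    if "w \<in> Ob (isocomma_gpd i u)" for w
    using that by (auto simp: isocomma_Ob)
  have "ent z 2 \<cdot>\<^bsub>Und (Tgt i)\<^esub> (FA (Fn i) h' \<cdot>\<^bsub>Und (Tgt i)\<^esub> FA (Fn i) h) =
      (FA (Fn u) k' \<cdot>\<^bsub>Und (Tgt i)\<^esub> FA (Fn u) k) \<cdot>\<^bsub>Und (Tgt i)\<^esub> ent x 2"
    using square_paste[OF cats(3) g[OF m'(5)] g[OF m'(6)] g[OF n'(5)]
        functor_Hom[OF i m'(2)] functor_Hom[OF i n'(2)]
        functor_Hom[OF fun_u m'(3)] functor_Hom[OF fun_u n'(3)] m'(4) n'(4)] .
  then show ?thesis
    unfolding isocomma_Cmp[OF m n] isocomma_Hom
    using m' n' functor_Cmp[OF i m'(2) n'(2)] functor_Cmp[OF fun_u m'(3) n'(3)]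
      category_Cmp[OF cats(1) m'(2) n'(2)] category_Cmp[OF cats(2) m'(3) n'(3)] by simp
qed

text \<open>Endpoints and the pair \<open>(h, k)\<close> determine an arrow, and pairs compose entry
  by entry. The laws are therefore inherited from the source groupoids of \<open>i\<close> and
  \<open>u\<close>.\<close>

lemma category_isocomma: "category (isocomma_gpd i u)"
proof (rule categoryI)
  fix m assume "m \<in> Ar (isocomma_gpd i u)"
  then show "Dom (isocomma_gpd i u) m \<in> Ob (isocomma_gpd i u) \<and>
      Cod (isocomma_gpd i u) m \<in> Ob (isocomma_gpd i u)"
    using in_HomI isocomma_Hom by metis
next
  fix x y m assume m: "m \<in> Hom (isocomma_gpd i u) x y"
  then obtain h k where m': "m = Tup [x, y, h, k]" "h \<in> Hom (Und (Src i)) (ent x 0) (ent y 0)"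
    "k \<in> Hom (Und (Src u)) (ent x 1) (ent y 1)"
    and xy: "x \<in> Ob (isocomma_gpd i u)" "y \<in> Ob (isocomma_gpd i u)"
    by (auto simp: isocomma_Hom)
  have "m \<cdot>\<^bsub>isocomma_gpd i u\<^esub> Idn (isocomma_gpd i u) x = m"
    unfolding isocomma_Cmp[OF isocomma_Idn_in[OF xy(1)] m]
    using m' category_unit_right[OF cats(1) m'(2)] category_unit_right[OF cats(2) m'(3)]
    by (simp add: isocomma_Idn[OF xy(1)])
  moreover have "Idn (isocomma_gpd i u) y \<cdot>\<^bsub>isocomma_gpd i u\<^esub> m = m"
    unfolding isocomma_Cmp[OF m isocomma_Idn_in[OF xy(2)]]
    using m' category_unit_left[OF cats(1) m'(2)] category_unit_left[OF cats(2) m'(3)]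
    by (simp add: isocomma_Idn[OF xy(2)])
  ultimately show "m \<cdot>\<^bsub>isocomma_gpd i u\<^esub> Idn (isocomma_gpd i u) x = m \<and>
      Idn (isocomma_gpd i u) y \<cdot>\<^bsub>isocomma_gpd i u\<^esub> m = m" by simp
next
  fix w x y z l m n
  assume l: "l \<in> Hom (isocomma_gpd i u) w x" and m: "m \<in> Hom (isocomma_gpd i u) x y"
    and n: "n \<in> Hom (isocomma_gpd i u) y z"
  have arr: "ent p 2 \<in> Hom (Und (Src i)) (ent a 0) (ent b 0)"
    "ent p 3 \<in> Hom (Und (Src u)) (ent a 1) (ent b 1)"
    if "p \<in> Hom (isocomma_gpd i u) a b" for p a b
    using that by (auto simp: isocomma_Hom)
  show "n \<cdot>\<^bsub>isocomma_gpd i u\<^esub> (m \<cdot>\<^bsub>isocomma_gpd i u\<^esub> l) = n \<cdot>\<^bsub>isocomma_gpd i u\<^esub> m \<cdot>\<^bsub>isocomma_gpd i u\<^esub> l"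
    using isocomma_Cmp[OF isocomma_Cmp_in[OF l m] n] isocomma_Cmp[OF l isocomma_Cmp_in[OF m n]]
      isocomma_Cmp[OF l m] isocomma_Cmp[OF m n] category_assoc[OF cats(1) arr(1)[OF l] arr(1)[OF m] arr(1)[OF n]]
      category_assoc[OF cats(2) arr(2)[OF l] arr(2)[OF m] arr(2)[OF n]] by simp
qed (fact isocomma_Idn_in isocomma_Cmp_in)+

text \<open>The inverse is the pair of inverses \<open>(h', k')\<close>. What needs an argument is
  that this pair satisfies the defining square from \<open>y\<close> back to
  \<open>x\<close>.\<close>

lemma iso_arrow_isocomma:
  assumes "m \<in> Ar (isocomma_gpd i u)"
  shows "iso_arrow (isocomma_gpd i u) m"
proof -
  obtain x y where m: "m \<in> Hom (isocomma_gpd i u) x y"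
    using in_HomI[OF assms] by blast
  then obtain h k where m': "m = Tup [x, y, h, k]" "h \<in> Hom (Und (Src i)) (ent x 0) (ent y 0)"
    "k \<in> Hom (Und (Src u)) (ent x 1) (ent y 1)"
    and sq: "ent y 2 \<cdot>\<^bsub>Und (Tgt i)\<^esub> FA (Fn i) h = FA (Fn u) k \<cdot>\<^bsub>Und (Tgt i)\<^esub> ent x 2"
    and xy: "x \<in> Ob (isocomma_gpd i u)" "y \<in> Ob (isocomma_gpd i u)"
    by (auto simp: isocomma_Hom)
  obtain h' where h': "h' \<in> Hom (Und (Src i)) (ent y 0) (ent x 0)"
    "h' \<cdot>\<^bsub>Und (Src i)\<^esub> h = Idn (Und (Src i)) (ent x 0)" "h \<cdot>\<^bsub>Und (Src i)\<^esub> h' = Idn (Und (Src i)) (ent y 0)"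
    using finite_groupoid_inverse[OF H m'(2)] .
  obtain k' where k': "k' \<in> Hom (Und (Src u)) (ent y 1) (ent x 1)"
    "k' \<cdot>\<^bsub>Und (Src u)\<^esub> k = Idn (Und (Src u)) (ent x 1)" "k \<cdot>\<^bsub>Und (Src u)\<^esub> k' = Idn (Und (Src u)) (ent y 1)"
    using finite_groupoid_inverse[OF K m'(3)] .
  let ?n = "Tup [y, x, h', k']"
  let ?C = "Und (Tgt i)"
  have g: "ent w 2 \<in> Hom ?C (FO (Fn i) (ent w 0)) (FO (Fn u) (ent w 1))"
    "ent w 0 \<in> Ob (Und (Src i))" "ent w 1 \<in> Ob (Und (Src u))"
    if "w \<in> Ob (isocomma_gpd i u)" for w
    using that by (auto simp: isocomma_Ob)
  note gx = g(1)[OF xy(1)] and gy = g(1)[OF xy(2)]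
  note ih = functor_Hom[OF i m'(2)] and ih' = functor_Hom[OF i h'(1)]
    and uk = functor_Hom[OF fun_u m'(3)] and uk' = functor_Hom[OF fun_u k'(1)]
  have ihh': "FA (Fn i) h \<cdot>\<^bsub>?C\<^esub> FA (Fn i) h' = Idn ?C (FO (Fn i) (ent y 0))"
    using functor_Cmp[OF i h'(1) m'(2)] h'(3) functor_Idn[OF i g(2)[OF xy(2)]] by simp
  have ukk': "FA (Fn u) k' \<cdot>\<^bsub>?C\<^esub> FA (Fn u) k = Idn ?C (FO (Fn u) (ent x 1))"
    using functor_Cmp[OF fun_u m'(3) k'(1)] k'(2) functor_Idn[OF fun_u g(3)[OF xy(1)]] by simp
  \<comment> \<open>Insert the identity \<open>u k'\<close> after \<open>u k\<close> in front,
    exchange \<open>u k\<close> after the structure arrow of \<open>x\<close> for the structure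
    arrow of \<open>y\<close> after \<open>i h\<close> by the square of \<open>m\<close>, and cancel
    \<open>i h\<close> against \<open>i h'\<close>.\<close>
  have "ent x 2 \<cdot>\<^bsub>?C\<^esub> FA (Fn i) h' =
      (FA (Fn u) k' \<cdot>\<^bsub>?C\<^esub> FA (Fn u) k) \<cdot>\<^bsub>?C\<^esub> (ent x 2 \<cdot>\<^bsub>?C\<^esub> FA (Fn i) h')"
    using ukk' category_unit_left[OF cats(3) category_Cmp[OF cats(3) ih' gx]] by simp
  also have "\<dots> = FA (Fn u) k' \<cdot>\<^bsub>?C\<^esub> ((FA (Fn u) k \<cdot>\<^bsub>?C\<^esub> ent x 2) \<cdot>\<^bsub>?C\<^esub> FA (Fn i) h')"
    using category_assoc[OF cats(3) category_Cmp[OF cats(3) ih' gx] uk uk']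
      category_assoc[OF cats(3) ih' gx uk] by simp
  also have "\<dots> = FA (Fn u) k' \<cdot>\<^bsub>?C\<^esub> (ent y 2 \<cdot>\<^bsub>?C\<^esub> (FA (Fn i) h \<cdot>\<^bsub>?C\<^esub> FA (Fn i) h'))"
    using category_assoc[OF cats(3) ih' ih gy] sq by simp
  also have "\<dots> = FA (Fn u) k' \<cdot>\<^bsub>?C\<^esub> ent y 2"
    using ihh' category_unit_right[OF cats(3) gy] by simp
  finally have n: "?n \<in> Hom (isocomma_gpd i u) y x"
    unfolding isocomma_Hom using xy h'(1) k'(1) by simp
  have "?n \<cdot>\<^bsub>isocomma_gpd i u\<^esub> m = Idn (isocomma_gpd i u) x"
    unfolding isocomma_Cmp[OF m n] isocomma_Idn[OF xy(1)] using m'(1) h'(2) k'(2) by simp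
  moreover have "m \<cdot>\<^bsub>isocomma_gpd i u\<^esub> ?n = Idn (isocomma_gpd i u) y"
    unfolding isocomma_Cmp[OF n m] isocomma_Idn[OF xy(2)] using m'(1) h'(3) k'(3) by simp
  ultimately have "inverse_arrows (isocomma_gpd i u) m ?n"
    using m n by (simp add: inverse_arrows_def Hom_iff)
  then show ?thesis by (auto simp: iso_arrow_def)
qed

lemma finite_groupoid_isocomma: "finite_groupoid (isocomma_gpd i u)"
proof -
  let ?A = "Ob (Und (Src i))" and ?B = "Ob (Und (Src u))" and ?C = "Ar (Und (Tgt i))"
  have "Ob (isocomma_gpd i u) \<subseteq> (\<lambda>(a, b, g). Tup [a, b, g]) ` (?A \<times> ?B \<times> ?C)"
    by (auto simp: isocomma_Ob Hom_iff image_iff)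
  moreover have "finite (?A \<times> ?B \<times> ?C)"
    using H K G by (simp add: finite_groupoid_def)
  ultimately have fin_Ob: "finite (Ob (isocomma_gpd i u))"
    by (meson finite_subset finite_imageI)
  let ?U = "Ob (isocomma_gpd i u)" and ?D = "Ar (Und (Src i))" and ?E = "Ar (Und (Src u))"
  \<comment> \<open>Arrows carry their endpoints, so the bound on their number uses the finiteness
    of the set of objects just shown.\<close>
  have "Ar (isocomma_gpd i u) \<subseteq> (\<lambda>(z, z', h, k). Tup [z, z', h, k]) ` (?U \<times> ?U \<times> ?D \<times> ?E)"
  proof
    fix m assume "m \<in> Ar (isocomma_gpd i u)"
    then obtain z z' h k where "m = Tup [z, z', h, k]" "z \<in> ?U" "z' \<in> ?U" "h \<in> ?D" "k \<in> ?E"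
      by (auto simp: isocomma_Ar Hom_iff)
    then show "m \<in> (\<lambda>(z, z', h, k). Tup [z, z', h, k]) ` (?U \<times> ?U \<times> ?D \<times> ?E)"
      by (auto simp: image_iff)
  qed
  moreover have "finite (?U \<times> ?U \<times> ?D \<times> ?E)"
    using H K fin_Ob by (simp add: finite_groupoid_def)
  ultimately have fin_Ar: "finite (Ar (isocomma_gpd i u))"
    by (meson finite_subset finite_imageI)
  have "Dom (isocomma_gpd i u) \<in> extensional (Ar (isocomma_gpd i u))"
    "Cod (isocomma_gpd i u) \<in> extensional (Ar (isocomma_gpd i u))"
    "Idn (isocomma_gpd i u) \<in> extensional (Ob (isocomma_gpd i u))"
    by (auto simp: isocomma_gpd_def Let_def)
  moreover have "n \<cdot>\<^bsub>isocomma_gpd i u\<^esub> m = undefined"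
    if "\<not> (m \<in> Ar (isocomma_gpd i u) \<and> n \<in> Ar (isocomma_gpd i u) \<and>
      Dom (isocomma_gpd i u) n = Cod (isocomma_gpd i u) m)" for n m
  proof -
    \<comment> \<open>The definition tests composability on entries; on arrows, entries 0 and 1 are
      the domain and the codomain.\<close>
    have "\<not> (m \<in> Ar (isocomma_gpd i u) \<and> n \<in> Ar (isocomma_gpd i u) \<and> ent n 0 = ent m 1)"
      using that isocomma_Dom isocomma_Cod by metis
    then show ?thesis by (simp only: isocomma_Cmp_eq if_False)
  qed
  ultimately show ?thesis
    using category_isocomma iso_arrow_isocomma fin_Ob fin_Ar
    unfolding finite_groupoid_def by blast
qed

lemma is_functor_pr1: "is_functor (isocomma_gpd i u) (Und (Src i)) pr1_fun"
  unfolding is_functor_def pr1_fun_def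
proof (intro conjI allI ballI impI)
  fix x y z m n assume m: "m \<in> Hom (isocomma_gpd i u) x y" and n: "n \<in> Hom (isocomma_gpd i u) y z"
  show "FA \<lparr>FO = \<lambda>z. ent z 0, FA = \<lambda>m. ent m 2\<rparr> (n \<cdot>\<^bsub>isocomma_gpd i u\<^esub> m) =
      FA \<lparr>FO = \<lambda>z. ent z 0, FA = \<lambda>m. ent m 2\<rparr> n \<cdot>\<^bsub>Und (Src i)\<^esub>
      FA \<lparr>FO = \<lambda>z. ent z 0, FA = \<lambda>m. ent m 2\<rparr> m"
    by (simp add: isocomma_Cmp[OF m n])
qed (auto simp: isocomma_Hom isocomma_Idn, auto simp: isocomma_Ob)

text \<open>In an arrow \<open>(h, k)\<close>, the defining square determines \<open>u k\<close> from \<open>h\<close>.\<close>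

lemma faithful_pr1:
  assumes "faithful (Und (Src u)) (Fn u)"
  shows "faithful (isocomma_gpd i u) pr1_fun"
  unfolding faithful_def
proof (intro ballI inj_onI)
  fix x y m n
  assume xy: "x \<in> Ob (isocomma_gpd i u)" "y \<in> Ob (isocomma_gpd i u)"
    and m: "m \<in> Hom (isocomma_gpd i u) x y" and n: "n \<in> Hom (isocomma_gpd i u) x y"
    and eq: "FA pr1_fun m = FA pr1_fun n"
  obtain h k where m': "m = Tup [x, y, h, k]" "k \<in> Hom (Und (Src u)) (ent x 1) (ent y 1)"
    "ent y 2 \<cdot>\<^bsub>Und (Tgt i)\<^esub> FA (Fn i) h = FA (Fn u) k \<cdot>\<^bsub>Und (Tgt i)\<^esub> ent x 2"
    using m by (auto simp: isocomma_Hom)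
  obtain k' where n': "n = Tup [x, y, h, k']" "k' \<in> Hom (Und (Src u)) (ent x 1) (ent y 1)"
    "ent y 2 \<cdot>\<^bsub>Und (Tgt i)\<^esub> FA (Fn i) h = FA (Fn u) k' \<cdot>\<^bsub>Und (Tgt i)\<^esub> ent x 2"
    using n eq m' by (auto simp: isocomma_Hom pr1_fun_def)
  have g: "ent x 2 \<in> Hom (Und (Tgt i)) (FO (Fn i) (ent x 0)) (FO (Fn u) (ent x 1))"
    and b: "ent x 1 \<in> Ob (Und (Src u))" "ent y 1 \<in> Ob (Und (Src u))"
    using xy by (auto simp: isocomma_Ob)
  have "FA (Fn u) k = FA (Fn u) k'"
    using finite_groupoid_cancel_right[OF G g functor_Hom[OF fun_u m'(2)] functor_Hom[OF fun_u n'(2)]]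
      m'(3) n'(3) by simp
  then have "k = k'"
    using assms b m'(2) n'(2) unfolding faithful_def inj_on_def by blast
  then show "m = n" using m' n' by simp
qed

end


section \<open>Objects and 1-morphisms of the ambient 2-category\<close>

lemma is_objD: "is_obj \<G> X \<Longrightarrow> finite_groupoid (Und X)"
  by (simp add: is_obj_def)

lemma is_morD:
  assumes "is_mor \<G> u"
  shows "is_obj \<G> (Src u)" "is_obj \<G> (Tgt u)" "is_functor (Und (Src u)) (Und (Tgt u)) (Fn u)"
  using assms by (auto simp: is_mor_def ext_functor_def)

text \<open>Over a group, the new structure functor is that of \<open>Y\<close> after
  \<open>F\<close>, and it is faithful as a composite of faithful functors.\<close>

lemma is_obj_restricted:
  assumes Y: "is_obj \<G> Y" and C: "finite_groupoid C"
    and F: "is_functor C (Und Y) F" and ff: "\<G> \<noteq> Gpd \<Longrightarrow> faithful C F"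
  shows "is_obj \<G> \<lparr>Und = C, Str = map_option (\<lambda>p. frestr C (fcomp p F)) (Str Y)\<rparr>"
proof (cases \<G>)
  case (GpdFOver \<Gamma>)
  then obtain p where p: "Str Y = Some p" "is_functor (Und Y) (deloop \<Gamma>) p" "faithful (Und Y) p"
    using Y by (auto simp: is_obj_def ext_functor_def)
  then show ?thesis
    using GpdFOver C F ff finite_groupoid_category[OF C] faithful_fcomp[OF F _ p(3)]
    by (simp add: is_obj_def ext_functor_frestr is_functor_fcomp faithful_frestr)
qed (use Y C in \<open>simp_all add: is_obj_def\<close>)

text \<open>The structure functor of \<open>X\<close> is by construction that of \<open>Y\<close>
  after \<open>F\<close>, so identities can serve as the comparison isomorphism. The shape of
  \<open>X\<close> is an equation so that isocommas (with \<open>pr1_fun\<close>) and full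
  subgroupoids (with \<open>fid\<close>) both fit.\<close>

lemma is_mor_strict:
  assumes amb: "is_ambient \<G>" and Y: "is_obj \<G> Y"
    and X: "X = \<lparr>Und = C, Str = map_option (\<lambda>p. frestr C (fcomp p F)) (Str Y)\<rparr>"
    and C: "finite_groupoid C"
    and F: "is_functor C (Und Y) F" and ff: "\<G> \<noteq> Gpd \<Longrightarrow> faithful C F"
  shows "is_mor \<G> (strict_mor \<G> X Y F)"
proof -
  note cat = finite_groupoid_category[OF C]
  have XO: "is_obj \<G> X"
    unfolding X using is_obj_restricted[OF Y C F ff] .
  have ext: "ext_functor C (Und Y) (frestr C F)"
    using ext_functor_frestr[OF cat F] .
  show ?thesis
  proof (cases \<G>)
    case (GpdFOver \<Gamma>)
    then have grp: "category (deloop \<Gamma>)" using amb by (simp add: is_ambient_def category_deloop)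
    obtain p where p: "Str Y = Some p" "is_functor (Und Y) (deloop \<Gamma>) p"
      using Y GpdFOver by (auto simp: is_obj_def ext_functor_def)
    let ?q = "frestr C (fcomp p F)"
    let ?\<theta> = "\<lambda>a\<in>Ob C. Idn (deloop \<Gamma>) (FO ?q a)"
    \<comment> \<open>On \<open>C\<close> the two functors agree, so naturality reduces to the unit
      laws of \<open>deloop \<Gamma>\<close>.\<close>
    have "nat_trans C (deloop \<Gamma>) ?q (fcomp p (frestr C F)) ?\<theta>"
      unfolding nat_trans_def
    proof (intro conjI ballI)
      fix a assume "a \<in> Ob C"
      then show "?\<theta> a \<in> Hom (deloop \<Gamma>) (FO ?q a) (FO (fcomp p (frestr C F)) a)"
        using category_Idn[OF grp] functor_Ob[OF p(2)] functor_Ob[OF F] by simp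
    next
      fix f assume f: "f \<in> Ar C"
      have "FA p (FA F f) \<in> Hom (deloop \<Gamma>) (FO p (FO F (Dom C f))) (FO p (FO F (Cod C f)))"
        using functor_Hom[OF p(2) functor_Hom[OF F in_HomI[OF f]]] .
      then show "?\<theta> (Cod C f) \<cdot>\<^bsub>deloop \<Gamma>\<^esub> FA ?q f =
          FA (fcomp p (frestr C F)) f \<cdot>\<^bsub>deloop \<Gamma>\<^esub> ?\<theta> (Dom C f)"
        using f category_Dom[OF cat f] category_Cod[OF cat f]
          category_unit_left[OF grp] category_unit_right[OF grp] by simp
    qed
    then show ?thesis
      using GpdFOver XO Y ext p(1) by (simp add: is_mor_def strict_mor_def X base_def)
  qed (use XO Y ext X ff in \<open>simp_all add: is_mor_def strict_mor_def is_obj_def faithful_frestr\<close>)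
qed

text \<open>In the faithful case, composites of faithful functors are faithful. Over a group, the
  composite comparison isomorphism is natural by pasting the naturality squares of
  \<open>\<theta>\<close> and \<open>\<psi>\<close>.\<close>

lemma is_mor_gcomp:
  assumes amb: "is_ambient \<G>" and v: "is_mor \<G> v" and u: "is_mor \<G> u" and tgt: "Tgt u = Src v"
  shows "is_mor \<G> (gcomp \<G> v u)"
proof -
  let ?C = "Und (Src u)"
  have cat: "category ?C"
    using is_objD[OF is_morD(1)[OF u]] by (rule finite_groupoid_category)
  note Fu = is_morD(3)[OF u, unfolded tgt] and Fv = is_morD(3)[OF v]
  have ext: "ext_functor ?C (Und (Tgt v)) (frestr ?C (fcomp (Fn v) (Fn u)))"
    using ext_functor_frestr[OF cat is_functor_fcomp[OF Fu Fv]] .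
  show ?thesis
  proof (cases \<G>)
    case Gpd
    then show ?thesis using ext u v by (simp add: is_mor_def gcomp_def)
  next
    case GpdF
    then show ?thesis
      using ext u v faithful_fcomp[OF Fu, of "Fn v"] tgt
      by (simp add: is_mor_def gcomp_def faithful_frestr)
  next
    case (GpdFOver \<Gamma>)
    then have grp: "category (deloop \<Gamma>)" using amb by (simp add: is_ambient_def category_deloop)
    obtain \<theta> where \<theta>: "Tw u = Some \<theta>"
      "nat_trans ?C (deloop \<Gamma>) (the (Str (Src u))) (fcomp (the (Str (Src v))) (Fn u)) \<theta>"
      using u GpdFOver tgt by (auto simp: is_mor_def)
    obtain \<psi> where \<psi>: "Tw v = Some \<psi>"
      "nat_trans (Und (Src v)) (deloop \<Gamma>) (the (Str (Src v))) (fcomp (the (Str (Tgt v))) (Fn v)) \<psi>"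
      using v GpdFOver by (auto simp: is_mor_def)
    have str: "is_functor (Und X) (deloop \<Gamma>) (the (Str X))" if "is_obj \<G> X" for X
      using that GpdFOver by (auto simp: is_obj_def ext_functor_def)
    let ?p = "the (Str (Src u))" and ?q = "the (Str (Src v))" and ?r = "the (Str (Tgt v))"
    note p = str[OF is_morD(1)[OF u]] and q = str[OF is_morD(1)[OF v]] and r = str[OF is_morD(2)[OF v]]
    let ?\<chi> = "\<lambda>a\<in>Ob ?C. \<psi> (FO (Fn u) a) \<cdot>\<^bsub>deloop \<Gamma>\<^esub> \<theta> a"
    have \<theta>_in: "\<theta> a \<in> Hom (deloop \<Gamma>) (FO ?p a) (FO ?q (FO (Fn u) a))" if "a \<in> Ob ?C" for a
      using \<theta>(2) that by (simp add: nat_trans_def)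
    have \<psi>_in: "\<psi> (FO (Fn u) a) \<in> Hom (deloop \<Gamma>) (FO ?q (FO (Fn u) a)) (FO ?r (FO (Fn v) (FO (Fn u) a)))"
      if "a \<in> Ob ?C" for a
      using \<psi>(2) functor_Ob[OF Fu that] by (simp add: nat_trans_def)
    have "nat_trans ?C (deloop \<Gamma>) ?p (fcomp ?r (frestr ?C (fcomp (Fn v) (Fn u)))) ?\<chi>"
      unfolding nat_trans_def
    proof (intro conjI ballI)
      fix a assume "a \<in> Ob ?C"
      then show "?\<chi> a \<in> Hom (deloop \<Gamma>) (FO ?p a) (FO (fcomp ?r (frestr ?C (fcomp (Fn v) (Fn u)))) a)"
        using category_Cmp[OF grp \<theta>_in \<psi>_in] by simp
    next
      fix f assume f: "f \<in> Ar ?C"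
      let ?a = "Dom ?C f" and ?b = "Cod ?C f"
      note ab = category_Dom[OF cat f] category_Cod[OF cat f]
      note f' = in_HomI[OF f]
      note uf = functor_Hom[OF Fu f']
      note pf = functor_Hom[OF p f'] and qf = functor_Hom[OF q uf]
        and rf = functor_Hom[OF r functor_Hom[OF Fv uf]]
      have 1: "\<theta> ?b \<cdot>\<^bsub>deloop \<Gamma>\<^esub> FA ?p f = FA ?q (FA (Fn u) f) \<cdot>\<^bsub>deloop \<Gamma>\<^esub> \<theta> ?a"
        using \<theta>(2) f by (simp add: nat_trans_def)
      have 2: "\<psi> (FO (Fn u) ?b) \<cdot>\<^bsub>deloop \<Gamma>\<^esub> FA ?q (FA (Fn u) f) =
          FA ?r (FA (Fn v) (FA (Fn u) f)) \<cdot>\<^bsub>deloop \<Gamma>\<^esub> \<psi> (FO (Fn u) ?a)"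
        using \<psi>(2) uf unfolding nat_trans_def Hom_iff fcomp_simps by metis
      show "?\<chi> ?b \<cdot>\<^bsub>deloop \<Gamma>\<^esub> FA ?p f =
          FA (fcomp ?r (frestr ?C (fcomp (Fn v) (Fn u)))) f \<cdot>\<^bsub>deloop \<Gamma>\<^esub> ?\<chi> ?a"
        \<comment> \<open>The three images of \<open>f\<close> in the group take the places of
          \<open>g1\<close>, \<open>g2\<close>, \<open>g3\<close>, and the components of
          \<open>\<theta>\<close> and \<open>\<psi>\<close> are the other edges. Hence
          \<open>1\<close> and \<open>2\<close> enter reversed, and the pasted equation is the goal
          read from right to left.\<close>
        using square_paste[OF grp pf qf rf \<theta>_in[OF ab(1)] \<psi>_in[OF ab(1)]
            \<theta>_in[OF ab(2)] \<psi>_in[OF ab(2)] 1[symmetric] 2[symmetric]] ab f by simp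
    qed
    then show ?thesis
      using GpdFOver u v ext \<theta>(1) \<psi>(1) by (simp add: is_mor_def gcomp_def base_def)
  qed
qed

text \<open>
  Over a group, the comparison isomorphism makes \<open>Str G \<circ> u\<close> isomorphic to the faithful \<open>Str H\<close>.
\<close>

lemma is_mor_faithful:
  assumes amb: "is_ambient \<G>" and u: "is_mor \<G> u" and ne: "\<G> \<noteq> Gpd"
  shows "faithful (Und (Src u)) (Fn u)"
proof (cases \<G>)
  case (GpdFOver \<Gamma>)
  then interpret group \<Gamma> using amb by (simp add: is_ambient_def)
  obtain \<theta> where \<theta>:
    "nat_trans (Und (Src u)) (deloop \<Gamma>) (the (Str (Src u))) (fcomp (the (Str (Tgt u))) (Fn u)) \<theta>"
    using u GpdFOver by (auto simp: is_mor_def)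
  have p: "is_functor (Und (Src u)) (deloop \<Gamma>) (the (Str (Src u)))"
    "faithful (Und (Src u)) (the (Str (Src u)))"
    using is_morD(1)[OF u] GpdFOver by (auto simp: is_obj_def ext_functor_def)
  show ?thesis
    unfolding faithful_def
  proof (intro ballI inj_onI)
    fix x y f g
    assume xy: "x \<in> Ob (Und (Src u))" "y \<in> Ob (Und (Src u))"
      and f: "f \<in> Hom (Und (Src u)) x y" and g: "g \<in> Hom (Und (Src u)) x y"
      and eq: "FA (Fn u) f = FA (Fn u) g"
    \<comment> \<open>By naturality, each side equals the image in the group of the common value
      \<open>FA (Fn u) f = FA (Fn u) g\<close>, composed with \<open>\<theta> x\<close>.\<close>
    have "\<theta> y \<cdot>\<^bsub>deloop \<Gamma>\<^esub> FA (the (Str (Src u))) f = \<theta> y \<cdot>\<^bsub>deloop \<Gamma>\<^esub> FA (the (Str (Src u))) g"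
      using \<theta> f g eq unfolding nat_trans_def Hom_iff fcomp_simps by metis
    moreover have "\<theta> y \<in> Atom ` carrier \<Gamma>"
      using \<theta> xy by (simp add: nat_trans_def deloop_sel)
    moreover have "FA (the (Str (Src u))) f \<in> Atom ` carrier \<Gamma>"
      "FA (the (Str (Src u))) g \<in> Atom ` carrier \<Gamma>"
      using functor_Hom[OF p(1) f] functor_Hom[OF p(1) g] by (simp_all add: deloop_sel)
    \<comment> \<open>This is an equation between products in the group, from which
      \<open>\<theta> y\<close> is cancelled on the left.\<close>
    ultimately have "FA (the (Str (Src u))) f = FA (the (Str (Src u))) g"
      by (auto simp: deloop_Cmp)
    then show "f = g"
      using p(2) xy f g unfolding faithful_def inj_on_def by blast
  qed
qed (use u ne in \<open>simp_all add: is_mor_def\<close>)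

section \<open>The 1-morphism \<open>p1\<close> and the formula at a level\<close>

lemma is_mor_pr1:
  assumes amb: "is_ambient \<G>" and i: "is_mor \<G> i" and u: "is_mor \<G> u" and tgt: "Tgt u = Tgt i"
  shows "is_mor \<G> (pr1 \<G> i u)"
proof -
  \<comment> \<open>These facts discharge the assumptions of the isocomma context, in their
    order.\<close>
  note fg = is_objD[OF is_morD(1)[OF i]] is_objD[OF is_morD(1)[OF u]] is_objD[OF is_morD(2)[OF i]]
    tgt is_morD(3)[OF i] is_morD(3)[OF u]
  show ?thesis
    unfolding pr1_def
    \<comment> \<open>\<open>isocomma_def\<close> is the shape of the source that
      \<open>is_mor_strict\<close> asks for. Outside the case \<open>Gpd\<close>, the 1-morphism
      \<open>u\<close> is faithful, and \<open>pr1\<close> inherits this.\<close>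
    using amb is_morD(1)[OF i] isocomma_def finite_groupoid_isocomma[OF fg] is_functor_pr1[OF fg]
      faithful_pr1[OF fg is_mor_faithful[OF amb u]]
    by (rule is_mor_strict)
qed

lemma is_mor_incl:
  assumes amb: "is_ambient \<G>" and X: "is_obj \<G> X"
  shows "is_mor \<G> (incl \<G> X S)"
proof -
  \<comment> \<open>The restricted structure functor is rewritten as a composite with
    \<open>fid\<close>, to match the shape required by \<open>is_mor_strict\<close>.\<close>
  have "sub X S = \<lparr>Und = full_sub (Und X) S,
      Str = map_option (\<lambda>p. frestr (full_sub (Und X) S) (fcomp p fid)) (Str X)\<rparr>"
    by (simp add: sub_def fcomp_def fid_def frestr_def map_option_case split: option.split)
  then show ?thesis
    unfolding incl_def
    using amb X finite_groupoid_full_sub[OF is_objD[OF X]]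
      is_functor_fid_full_sub[OF finite_groupoid_category[OF is_objD[OF X]]] faithful_fid
    by (intro is_mor_strict[where C = "full_sub (Und X) S"])
qed

text \<open>The levels of a family are \<open>undefined\<close> outside \<open>over\<close>, so a
  family over \<open>Src j\<close> can be evaluated at \<open>pull_ff\<close> only once this
  membership is known.\<close>

lemma pull_ff_over:
  assumes amb: "is_ambient \<G>" and j: "is_mor \<G> j" and \<sigma>: "\<sigma> \<in> over \<G> (Tgt j)"
  shows "pull_ff \<G> j \<sigma> \<in> over \<G> (Src j)"
proof -
  have pr1: "is_mor \<G> (pr1 \<G> j \<sigma>)"
    using amb j \<sigma> by (intro is_mor_pr1) (simp_all add: over_def)
  have src: "Src (pr1 \<G> j \<sigma>) = isocomma j \<sigma>" "Tgt (pr1 \<G> j \<sigma>) = Src j"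
    by (simp_all add: pr1_def strict_mor_def)
  have "is_mor \<G> (incl \<G> (isocomma j \<sigma>) S)" for S
    \<comment> \<open>That the isocomma is an object of the ambient is read off from
      \<open>pr1\<close> being a 1-morphism.\<close>
    using is_mor_incl[OF amb] is_morD(1)[OF pr1] src by simp
  then have "is_mor \<G> (pull_ff \<G> j \<sigma>)"
    unfolding pull_ff_def using amb pr1 src
    by (intro is_mor_gcomp) (simp_all add: incl_def strict_mor_def)
  moreover have "Tgt (pull_ff \<G> j \<sigma>) = Src j"
    using src by (simp add: pull_ff_def gcomp_def)
  ultimately show ?thesis by (simp add: over_def)
qed

text \<open>Both sides agree by unfolding. The first hypothesis opens the restricted
  \<open>Lev\<close> of the induced family, the second that of the family \<open>eta_sup\<close>
  assigns to \<open>x\<close>.\<close>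

lemma Lev_mark:
  assumes "K \<in> over \<G> (Tgt H)" "pull_ff \<G> H K \<in> over \<G> (Src H)"
  shows "Lev (FO (mark \<G> \<A> G) (H, x)) K =
    FO (Ind (folding_ind \<G> \<A> (nabla \<G> H K))) (FO (Res \<A> (pull_ff \<G> H K)) x)"
  using assms
  by (simp add: mark_def eps_plus_def plus_fun_def eta_sup_def sup_mackey_def sup_ind_def
      sup_ind_fam_def Let_def)

theorem theorem9p8:
  fixes \<G> :: "'a ambient" and \<A> :: "('a, 'o, 'm) rfun" and G :: "'a gobj"
    and H K :: "'a gmor" and x :: 'o
  assumes "is_ambient \<G>"
    and "restriction_2functor \<G> \<A>"
    and "is_obj \<G> G"
    and "(H, x) \<in> Ob (plus_cat \<G> \<A> G)"
    and "K \<in> over \<G> G"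
    and "S = \<Union>{M \<in> components (Und (isocomma H K)).
               fully_faithful_on (Und (isocomma H K)) (Und (Src K)) (Fn (pr2 \<G> H K)) M}"
    and "p1 = gcomp \<G> (pr1 \<G> H K) (incl \<G> (isocomma H K) S)"
    and "p2 = gcomp \<G> (pr2 \<G> H K) (incl \<G> (isocomma H K) S)"
  shows "Lev (FO (mark \<G> \<A> G) (H, x)) K = FO (Ind (folding_ind \<G> \<A> p2)) (FO (Res \<A> p1) x)"
proof -
  have H: "is_mor \<G> H" "Tgt H = G"
    using assms(4) by (auto simp: plus_cat_def plus_objs_def over_faithful_def over_def)
  \<comment> \<open>\<open>ff_part\<close> takes its groupoids from the 1-morphism; for
    \<open>pr2\<close> they are the isocomma and \<open>Src K\<close>.\<close>
  have "S = ff_part (pr2 \<G> H K)"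
    unfolding assms(6) by (simp add: ff_part_def pr2_def)
  then have "p1 = pull_ff \<G> H K" "p2 = nabla \<G> H K"
    by (simp_all add: assms(7,8) pull_ff_def nabla_def)
  then show ?thesis
    using Lev_mark[of K \<G> H] pull_ff_over[OF assms(1) H(1)] assms(5) H(2) by simp
qed

end
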